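(* For every positive rational number $r$ and every integer $k$ with $1\leq k\leq 200$, $$\mathcal{T}_{1/2,k}(q)\succeq_q \mathcal{T}_{r,k}(q).$$
   Context: For $n\ge 0$, $(z;q)_n:=\prod_{j=0}^{n-1}(1-zq^j)$, with $(z;q)_0:=1$. Let $\mathcal{P}:=\bigcup_{M\geq 1}\mathbb{Q}[[q^{1/M}]]$ be the directed union of the rings of fractional power series (exponents are nonnegative rationals with a common denominator). If $F(q)=\sum_{\alpha\in\frac1M\mathbb{Z}_{\ge0}}c(\alpha)q^\alpha\in\mathcal{P}$, its integer trace is $\operatorname{Tr}_{\mathbb{Z}}(F):=\sum_{n\geq 0}c(n)q^n\in\mathbb{Q}[[q]]$, the sum running over integers $n\ge 0$ (all terms with non-integer exponent are discarded). For a positive rational number $r$ and an integer $k\geq 0$, set $$G_{r,k}(q):=\frac{(q^{r+1};q)_k}{(q;q)_k}\in\mathcal{P},\qquad \mathcal{T}_{r,k}(q):=\operatorname{Tr}_{\mathbb{Z}}(G_{r,k}(q))\in\mathbb{Z}[[q]].$$ For $F,G\in\mathbb{Q}[[q]]$, write $F\succeq_q G$ if for every integer $n\geq 0$ the coefficient of $q^n$ in $F-G$ is $\geq 0$. *)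

theory Defs
  imports "HOL-Computational_Algebra.Formal_Power_Series"
begin

text \<open>The ring of fractional power series, the union of the \<open>\<rat>[[q\<^bsup>1/M\<^esup>]]\<close> over all
  \<open>M \<ge> 1\<close>: an element is given by its coefficients, indexed by the exponents.\<close>

typedef fracps =
  "{f :: rat \<Rightarrow> rat. \<exists>M>0. \<forall>a. f a \<noteq> 0 \<longrightarrow> (\<exists>n. a = of_nat n / of_nat M)}"
  morphisms fcoeff Abs_fracps
  by (rule exI[of _ "\<lambda>_. 0"]) auto

setup_lifting type_definition_fracps

lemma fracps_eqI: "(\<And>a. fcoeff F a = fcoeff G a) \<Longrightarrow> F = G"
  by (metis ext fcoeff_inject)

lemma frac_mult_exponent:
  "0 < (M::nat) \<Longrightarrow> \<exists>n'. of_nat n / of_nat N = (of_nat n' / of_nat (M * N) :: rat)"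
  by (rule exI[of _ "n * M"]) (auto simp: field_simps)

lemma frac_mult_exponent':
  "0 < (M::nat) \<Longrightarrow> \<exists>n'. of_nat n / of_nat N = (of_nat n' / of_nat (N * M) :: rat)"
  using frac_mult_exponent[of M n N] by (simp only: mult.commute)

instantiation fracps :: "{zero, one, plus, minus, uminus, times}"
begin

lift_definition zero_fracps :: fracps is "\<lambda>_. 0" by auto

lift_definition one_fracps :: fracps is "\<lambda>a. if a = 0 then 1 else 0"
  by (intro exI[of _ 1]) auto

lift_definition plus_fracps :: "fracps \<Rightarrow> fracps \<Rightarrow> fracps" is "\<lambda>f g a. f a + g a"
proof -
  fix f g :: "rat \<Rightarrow> rat"
  assume "\<exists>M>0. \<forall>a. f a \<noteq> 0 \<longrightarrow> (\<exists>n. a = of_nat n / of_nat M)"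
    and "\<exists>M>0. \<forall>a. g a \<noteq> 0 \<longrightarrow> (\<exists>n. a = of_nat n / of_nat M)"
  then obtain M N where M: "M > 0" "\<And>a. f a \<noteq> 0 \<Longrightarrow> \<exists>n. a = of_nat n / of_nat M"
    and N: "N > 0" "\<And>a. g a \<noteq> 0 \<Longrightarrow> \<exists>n. a = of_nat n / of_nat N" by auto
  show "\<exists>M>0. \<forall>a. f a + g a \<noteq> 0 \<longrightarrow> (\<exists>n. a = of_nat n / of_nat M)"
  proof (rule exI[of _ "M * N"], intro conjI allI impI)
    fix a assume "f a + g a \<noteq> 0"
    then have "f a \<noteq> 0 \<or> g a \<noteq> 0" by auto
    then consider m where "a = of_nat m / of_nat M" | n where "a = of_nat n / of_nat N"
      using M(2) N(2) by blast
    then show "\<exists>n. a = of_nat n / of_nat (M * N)"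
      by cases (use frac_mult_exponent[OF M(1)] frac_mult_exponent'[OF N(1)] in blast)+
  qed (use M N in auto)
qed

lift_definition uminus_fracps :: "fracps \<Rightarrow> fracps" is "\<lambda>f a. - f a" by auto

definition minus_fracps :: "fracps \<Rightarrow> fracps \<Rightarrow> fracps" where
  "minus_fracps F G = F + (- G)"

lift_definition times_fracps :: "fracps \<Rightarrow> fracps \<Rightarrow> fracps" is
  "\<lambda>f g c. \<Sum>(a, b) \<in> {(a, b). a + b = c \<and> f a \<noteq> 0 \<and> g b \<noteq> 0}. f a * g b"
proof -
  fix f g :: "rat \<Rightarrow> rat"
  assume "\<exists>M>0. \<forall>a. f a \<noteq> 0 \<longrightarrow> (\<exists>n. a = of_nat n / of_nat M)"
    and "\<exists>M>0. \<forall>a. g a \<noteq> 0 \<longrightarrow> (\<exists>n. a = of_nat n / of_nat M)"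
  then obtain M N where M: "M > 0" "\<And>a. f a \<noteq> 0 \<Longrightarrow> \<exists>n. a = of_nat n / of_nat M"
    and N: "N > 0" "\<And>a. g a \<noteq> 0 \<Longrightarrow> \<exists>n. a = of_nat n / of_nat N" by auto
  show "\<exists>M>0. \<forall>c. (\<Sum>(a, b) \<in> {(a, b). a + b = c \<and> f a \<noteq> 0 \<and> g b \<noteq> 0}. f a * g b) \<noteq> 0
          \<longrightarrow> (\<exists>n. c = of_nat n / of_nat M)"
  proof (rule exI[of _ "M * N"], intro conjI allI impI)
    fix c assume "(\<Sum>(a, b) \<in> {(a, b). a + b = c \<and> f a \<noteq> 0 \<and> g b \<noteq> 0}. f a * g b) \<noteq> 0"
    then obtain x where "x \<in> {(a, b). a + b = c \<and> f a \<noteq> 0 \<and> g b \<noteq> 0}"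
      by (rule sum.not_neutral_contains_not_neutral)
    then obtain a b where ab: "a + b = c" "f a \<noteq> 0" "g b \<noteq> 0" by auto
    obtain i j where "a = of_nat i / of_nat M" "b = of_nat j / of_nat N"
      using M(2)[OF ab(2)] N(2)[OF ab(3)] by auto
    then have "c = of_nat (i * N + j * M) / of_nat (M * N)"
      using M(1) N(1) ab(1) by (auto simp: field_simps)
    then show "\<exists>n. c = of_nat n / of_nat (M * N)" by blast
  qed (use M N in auto)
qed

instance ..

end

text \<open>The embedding of \<open>\<rat>[[q]]\<close> given by \<open>q \<mapsto> q\<^bsup>1/M\<^esup>\<close>.\<close>

lift_definition fps_root :: "nat \<Rightarrow> rat fps \<Rightarrow> fracps" is
  "\<lambda>M f a. if \<exists>n. a = of_nat n / of_nat M then fps_nth f (nat \<lfloor>a * of_nat M\<rfloor>) else 0"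
proof -
  fix M :: nat and f :: "rat fps"
  show "\<exists>K>0. \<forall>a. (if \<exists>n. a = of_nat n / of_nat M then fps_nth f (nat \<lfloor>a * of_nat M\<rfloor>) else 0) \<noteq> 0
         \<longrightarrow> (\<exists>n. a = of_nat n / of_nat K)"
    by (cases "M = 0") (auto intro: exI[of _ 1] exI[of _ M] split: if_splits)
qed

lemma fcoeff_fps_root:
  "M > 0 \<Longrightarrow> fcoeff (fps_root M f) (of_nat n / of_nat M) = fps_nth f n"
  by transfer auto

lemma fcoeff_fps_root_0:
  "(\<And>n. a \<noteq> of_nat n / of_nat M) \<Longrightarrow> fcoeff (fps_root M f) a = 0"
  by transfer auto

lemma fps_root_eqI:
  fixes F :: fracps
  assumes "\<And>n. fcoeff F (of_nat n / of_nat M) = fps_nth f n"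
    and "\<And>a :: rat. (\<And>n. a \<noteq> of_nat n / of_nat M) \<Longrightarrow> fcoeff F a = 0" and "M > 0"
  shows "fps_root M f = F"
proof (rule fracps_eqI)
  fix a :: rat show "fcoeff (fps_root M f) a = fcoeff F a"
    by (cases "\<exists>n. a = of_nat n / of_nat M")
       (use assms in \<open>auto simp: fcoeff_fps_root fcoeff_fps_root_0\<close>)
qed

lemma fracps_as_fps_root:
  obtains M where "M > 0" "\<And>N. M dvd N \<Longrightarrow> N > 0 \<Longrightarrow> \<exists>f. F = fps_root N f"
proof -
  obtain M where M: "M > 0" "\<And>a. fcoeff F a \<noteq> 0 \<Longrightarrow> \<exists>n. a = of_nat n / of_nat M"
    using fcoeff[of F] by auto
  have "\<exists>f. F = fps_root N f" if N: "M dvd N" "N > 0" for N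
  proof -
    obtain K where K: "N = K * M" "K > 0" using N by (auto elim!: dvdE simp: mult.commute)
    have "fps_root N (Abs_fps (\<lambda>n. fcoeff F (of_nat n / of_nat N))) = F"
    proof (rule fps_root_eqI)
      fix a :: rat assume *: "\<And>n. a \<noteq> of_nat n / of_nat N"
      show "fcoeff F a = 0"
        using M(2)[of a] * frac_mult_exponent[OF K(2), of _ M] K(1) by metis
    qed (use N in auto)
    then show ?thesis by metis
  qed
  then show ?thesis using that M(1) by blast
qed

lemma fps_root_0: "M > 0 \<Longrightarrow> fps_root M 0 = 0"
  by (rule fps_root_eqI) (auto simp: zero_fracps.rep_eq)

lemma fps_root_1: 
  assumes "M > 0"
  shows "fps_root M 1 = 1"
proof (rule fps_root_eqI)
  fix a :: rat assume *: "\<And>n. a \<noteq> of_nat n / of_nat M"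
  from *[of 0] show "fcoeff 1 a = 0" by (simp add: one_fracps.rep_eq)
qed (use assms in \<open>auto simp: one_fracps.rep_eq\<close>)

lemma fps_root_add: "M > 0 \<Longrightarrow> fps_root M (f + g) = fps_root M f + fps_root M g"
  by (rule fps_root_eqI) (auto simp: plus_fracps.rep_eq fcoeff_fps_root fcoeff_fps_root_0)

lemma fps_root_uminus: "M > 0 \<Longrightarrow> fps_root M (- f) = - fps_root M f"
  by (rule fps_root_eqI) (auto simp: uminus_fracps.rep_eq fcoeff_fps_root fcoeff_fps_root_0)

lemma fps_root_diff: "M > 0 \<Longrightarrow> fps_root M (f - g) = fps_root M f - fps_root M g"
  using fps_root_add[of M f "- g"] by (simp add: minus_fracps_def fps_root_uminus)

lemma fps_root_mult:
  assumes "M > 0"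
  shows "fps_root M (f * g) = fps_root M f * fps_root M g"
proof (rule fps_root_eqI)
  let ?F = "fcoeff (fps_root M f)" and ?G = "fcoeff (fps_root M g)"
  let ?S = "\<lambda>c. {(a, b). a + b = c \<and> ?F a \<noteq> 0 \<and> ?G b \<noteq> 0}"
  have S: "\<exists>i j. a = of_nat i / of_nat M \<and> b = of_nat j / of_nat M \<and> c = of_nat (i + j) / of_nat M"
    if "(a, b) \<in> ?S c" for a b c
  proof -
    from that have "?F a \<noteq> 0" "?G b \<noteq> 0" "a + b = c" by auto
    moreover from this obtain i j where "a = of_nat i / of_nat M" "b = of_nat j / of_nat M"
      using fcoeff_fps_root_0 by metis
    ultimately show ?thesis by (auto simp: add_divide_distrib)
  qed
  {
    fix n
    let ?h = "\<lambda>i. (of_nat i / of_nat M :: rat, of_nat (n - i) / of_nat M :: rat)"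
    have inj: "inj_on ?h {0..n}" using assms by (auto simp: inj_on_def)
    have "fcoeff (fps_root M f * fps_root M g) (of_nat n / of_nat M) =
        (\<Sum>(a, b) \<in> ?S (of_nat n / of_nat M). ?F a * ?G b)"
      by (simp add: times_fracps.rep_eq)
    also have "\<dots> = (\<Sum>(a, b) \<in> ?h ` {0..n}. ?F a * ?G b)"
    proof (rule sum.mono_neutral_left)
      show "?S (of_nat n / of_nat M) \<subseteq> ?h ` {0..n}"
      proof
        fix x assume x: "x \<in> ?S (of_nat n / of_nat M)"
        obtain a b where ab: "x = (a, b)" by fastforce
        obtain i j where ij: "a = of_nat i / of_nat M" "b = of_nat j / of_nat M"
          "(of_nat n / of_nat M :: rat) = of_nat (i + j) / of_nat M"
          using S x ab by blast
        have "(of_nat n :: rat) = of_nat (i + j)" using ij(3) assms by simp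
        then have "n = i + j" by (simp only: of_nat_eq_iff)
        then have "x = ?h i" "i \<in> {0..n}" using ij ab by auto
        then show "x \<in> ?h ` {0..n}" by blast
      qed
      show "\<forall>x\<in>?h ` {0..n} - ?S (of_nat n / of_nat M). (case x of (a, b) \<Rightarrow> ?F a * ?G b) = 0"
        by (auto simp: add_divide_distrib[symmetric] of_nat_diff)
    qed auto
    also have "\<dots> = (\<Sum>i=0..n. fps_nth f i * fps_nth g (n - i))"
      by (subst sum.reindex[OF inj]) (simp add: fcoeff_fps_root assms del: of_nat_diff)
    finally show "fcoeff (fps_root M f * fps_root M g) (of_nat n / of_nat M) = fps_nth (f * g) n"
      by (simp add: fps_mult_nth)
  }
  fix c :: rat assume "\<And>n. c \<noteq> of_nat n / of_nat M"
  then have "?S c = {}" using S by fast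
  then show "fcoeff (fps_root M f * fps_root M g) c = 0"
    unfolding times_fracps.rep_eq by (metis sum.empty)
qed fact

lemma fracps_common:
  obtains M f g h where "M > 0" "F = fps_root M f" "G = fps_root M g" "H = fps_root M h"
proof -
  obtain A where A: "A > 0" "\<And>N. A dvd N \<Longrightarrow> N > 0 \<Longrightarrow> \<exists>f. F = fps_root N f"
    using fracps_as_fps_root by blast
  obtain B where B: "B > 0" "\<And>N. B dvd N \<Longrightarrow> N > 0 \<Longrightarrow> \<exists>f. G = fps_root N f"
    using fracps_as_fps_root by blast
  obtain C where C: "C > 0" "\<And>N. C dvd N \<Longrightarrow> N > 0 \<Longrightarrow> \<exists>f. H = fps_root N f"
    using fracps_as_fps_root by blast
  have "A * B * C > 0" using A B C by simp
  moreover obtain f where "F = fps_root (A * B * C) f"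
    using A(2)[of "A * B * C"] calculation by auto
  moreover obtain g where "G = fps_root (A * B * C) g"
    using B(2)[of "A * B * C"] calculation(1) by auto
  moreover obtain h where "H = fps_root (A * B * C) h"
    using C(2)[of "A * B * C"] calculation(1) by auto
  ultimately show ?thesis by (rule that)
qed

instance fracps :: comm_ring_1
proof
  fix F G H :: fracps
  obtain M f g h where M: "M > 0" and eq: "F = fps_root M f" "G = fps_root M g" "H = fps_root M h"
    by (rule fracps_common)
  note hom = fps_root_add[OF M, symmetric] fps_root_mult[OF M, symmetric]
    fps_root_1[OF M, symmetric] fps_root_0[OF M, symmetric]
    fps_root_uminus[OF M, symmetric] fps_root_diff[OF M, symmetric]
  show "F + G + H = F + (G + H)" "F + G = G + F" "0 + F = F" "- F + F = 0" "F - G = F + - G"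
    "F * G * H = F * (G * H)" "F * G = G * F" "1 * F = F" "(F + G) * H = F * H + G * H"
    unfolding eq hom by (simp_all add: algebra_simps)
  show "(0::fracps) \<noteq> 1"
    by (metis one_fracps.rep_eq zero_fracps.rep_eq zero_neq_one)
qed

text \<open>Division by units (the quotient is only meaningful if the divisor is one); non-units get
  the junk value \<open>0\<close>.\<close>

instantiation fracps :: inverse
begin

definition inverse_fracps :: "fracps \<Rightarrow> fracps" where
  "inverse_fracps F = (if F dvd 1 then THE H. F * H = 1 else 0)"

definition divide_fracps :: "fracps \<Rightarrow> fracps \<Rightarrow> fracps" where
  "divide_fracps F G = F * inverse G"

instance ..

end

lemma fracps_inverse_unique:
  fixes F H :: fracps
  assumes "F * H = 1"
  shows "inverse F = H"
proof -
  have "(THE H. F * H = 1) = H"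
  proof (rule the_equality)
    show "F * H = 1" by (fact assms)
    fix K assume "F * K = 1"
    then show "K = H" using assms by (metis mult.assoc mult.commute mult_1_right)
  qed
  moreover have "F dvd 1" using assms by (metis dvdI)
  ultimately show ?thesis by (simp add: inverse_fracps_def)
qed

lemma fps_root_divide:
  assumes "M > 0" "fps_nth g 0 \<noteq> 0"
  shows "fps_root M (f / g) = fps_root M f / fps_root M g"
proof -
  have "g * inverse g = 1" using assms(2) by (simp add: inverse_mult_eq_1')
  then have "fps_root M g * fps_root M (inverse g) = 1"
    using assms(1) by (metis fps_root_mult fps_root_1)
  then have "inverse (fps_root M g) = fps_root M (inverse g)" by (rule fracps_inverse_unique)
  then show ?thesis
    using assms by (simp add: divide_fracps_def fps_divide_unit fps_root_mult)
qed

text \<open>The monomial \<open>q\<^sup>a\<close>; the value for \<open>a < 0\<close> is the junk value \<open>0\<close>.\<close>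

lift_definition qpow :: "rat \<Rightarrow> fracps" is "\<lambda>a x. if x = a \<and> a \<ge> 0 then 1 else 0"
proof -
  fix a :: rat
  obtain m n where q: "quotient_of a = (m, n)" by fastforce
  then have a: "a = of_int m / of_int n" "n > 0"
    by (auto simp: quotient_of_div dest: quotient_of_denom_pos)
  have "a = of_nat (nat m) / of_nat (nat n)" if "a \<ge> 0"
    using a that by (simp add: zero_le_divide_iff of_nat_nat)
  then show "\<exists>M>0. \<forall>x. (if x = a \<and> a \<ge> 0 then 1 else 0) \<noteq> (0::rat)
      \<longrightarrow> (\<exists>n. x = of_nat n / of_nat M)"
    using a(2) by (intro exI[of _ "nat n"]) auto
qed

lemma fps_root_X_power:
  assumes "M > 0"
  shows "fps_root M (fps_X ^ n) = qpow (of_nat n / of_nat M)"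
  by (rule fps_root_eqI) (use assms in \<open>auto simp: qpow.rep_eq\<close>)

definition qpoch :: "'a::comm_ring_1 \<Rightarrow> 'a \<Rightarrow> nat \<Rightarrow> 'a" where
  "qpoch z q n = (\<Prod>j<n. 1 - z * q ^ j)"

definition int_trace :: "fracps \<Rightarrow> rat fps" where
  "int_trace F = Abs_fps (\<lambda>n. fcoeff F (of_nat n))"

definition G_series :: "rat \<Rightarrow> nat \<Rightarrow> fracps" where
  "G_series r k = qpoch (qpow (r + 1)) (qpow 1) k / qpoch (qpow 1) (qpow 1) k"

text \<open>The divisor in \<^const>\<open>G_series\<close> is a unit.\<close>

lemma qpoch_q_q_mult_inverse:
  "qpoch (qpow 1) (qpow 1) k * inverse (qpoch (qpow 1) (qpow 1) k) = 1"
proof -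
  have root: "fps_root 1 (\<Prod>j<k. 1 - fps_X * fps_X ^ j) = qpoch (qpow 1) (qpow 1) k"
  proof (induction k)
    case 0
    then show ?case by (simp add: qpoch_def fps_root_1)
  next
    case (Suc k)
    have X: "fps_root (Suc 0) fps_X = qpow 1" using fps_root_X_power[of 1 1] by simp
    have "fps_root 1 (fps_X ^ j) = qpow 1 ^ j" for j
      by (induction j) (simp_all add: fps_root_1 fps_root_mult X)
    with Suc X show ?case
      by (simp add: qpoch_def fps_root_mult fps_root_diff fps_root_1)
  qed
  let ?g = "\<Prod>j<k. 1 - fps_X * fps_X ^ j :: rat fps"
  have g: "fps_nth ?g 0 = 1" by (induction k) simp_all
  then have "?g / ?g = 1" by (simp add: fps_divide_unit inverse_mult_eq_1')
  moreover have "fps_root 1 (?g / ?g) = fps_root 1 ?g / fps_root 1 ?g"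
    using g by (simp add: fps_root_divide)
  ultimately have "fps_root 1 ?g / fps_root 1 ?g = fps_root 1 1" by simp
  then show ?thesis unfolding root divide_fracps_def by (simp add: fps_root_1)
qed

definition T_series :: "rat \<Rightarrow> nat \<Rightarrow> rat fps" where
  "T_series r k = int_trace (G_series r k)"

definition coeff_ge :: "rat fps \<Rightarrow> rat fps \<Rightarrow> bool" (infix "\<succeq>\<^sub>q" 50) where
  "F \<succeq>\<^sub>q G \<longleftrightarrow> (\<forall>n. fps_nth (F - G) n \<ge> 0)"

end

theory Submission
  imports Defs
begin

text \<open>
  Put \<open>c\<^sub>i = q\<^bsup>i(i+1)/2\<^esup> / ((q;q)\<^sub>i (q;q)\<^bsub>k-i\<^esub>)\<close>. The \<open>q\<close>-binomial theorem gives
  \<open>\<T>\<^bsub>r,k\<^esub> = \<Sum> (-1)\<^sup>i q\<^bsup>ri\<^esup> c\<^sub>i\<close>, summed over the \<open>i \<le> k\<close> with \<open>ri \<in> \<int>\<close>. Discarding the odd \<open>i\<close> only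
  increases the coefficients, so \<open>\<T>\<^bsub>r,k\<^esub>\<close> is bounded by the sum of \<open>q\<^bsup>Ae/h\<^esup> c\<^bsub>2e\<^esub>\<close> over the multiples
  \<open>e\<close> of some \<open>h\<close>, where \<open>2r = A/h\<close>, while \<open>\<T>\<^bsub>1/2,k\<^esub>\<close> is the sum of \<open>t\<^sub>e = q\<^sup>e c\<^bsub>2e\<^esub>\<close> over all \<open>e\<close>.
  The key inequality is \<open>c\<^bsub>2e\<^esub> (1 - q\<^sup>e) \<preceq> t\<^bsub>e-1\<^esub> + t\<^bsub>e+1\<^esub>\<close> for \<open>e \<ge> 2\<close>: what the term \<open>e\<close> exceeds
  \<open>t\<^sub>e\<close> by is paid for by its two neighbours, and for \<open>h \<ge> 3\<close> the neighbours of different multiples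
  of \<open>h\<close> are disjoint. For \<open>h = 2\<close> every odd index serves two multiples, but there the excess is
  only half as large, because \<open>2 (q\<^sup>m - q\<^bsup>2m\<^esup>) = (1 - q\<^bsup>2m\<^esup>) - (1 - q\<^sup>m)\<^sup>2\<close>.

  To prove the key inequality, factors common to all its terms are split off. Since \<open>1/(1 - q)\<close>
  is among them, it is enough to compare partial sums of coefficients, or double partial sums when
  \<open>1/(1 - q)\<^sup>2\<close> is available. If \<open>k - 2e \<le> 2e + 1\<close>, then \<open>t\<^bsub>e-1\<^esub>\<close> alone suffices; otherwise \<open>c\<^bsub>2e+2\<^esub>\<close>
  is first bounded below by a multiple of \<open>c\<^bsub>2e\<^esub>\<close>, which removes the dependence on \<open>k\<close>.
\<close>

section \<open>The coefficientwise order on power series\<close>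

lemma coeff_ge_iff: "F \<succeq>\<^sub>q G \<longleftrightarrow> (\<forall>n. fps_nth G n \<le> fps_nth F n)"
  by (simp add: coeff_ge_def)

lemma coeff_ge_diff: "F \<succeq>\<^sub>q G \<longleftrightarrow> F - G \<succeq>\<^sub>q 0"
  by (simp add: coeff_ge_def)

lemma coeff_ge_refl [simp]: "F \<succeq>\<^sub>q F"
  by (simp add: coeff_ge_iff)

lemma coeff_ge_trans [trans]: "F \<succeq>\<^sub>q G \<Longrightarrow> G \<succeq>\<^sub>q H \<Longrightarrow> F \<succeq>\<^sub>q H"
  unfolding coeff_ge_iff by (meson order_trans)

lemma coeff_ge_add: "F \<succeq>\<^sub>q G \<Longrightarrow> F' \<succeq>\<^sub>q G' \<Longrightarrow> F + F' \<succeq>\<^sub>q G + G'"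
  by (simp add: coeff_ge_iff add_mono)

lemma coeff_nonneg_add [simp]: "F \<succeq>\<^sub>q 0 \<Longrightarrow> G \<succeq>\<^sub>q 0 \<Longrightarrow> F + G \<succeq>\<^sub>q 0"
  using coeff_ge_add[of F 0 G 0] by simp

lemma coeff_ge_add_nonneg: "H \<succeq>\<^sub>q 0 \<Longrightarrow> F + H \<succeq>\<^sub>q F"
  by (simp add: coeff_ge_iff)

lemma coeff_ge_sum: "(\<And>i. i \<in> S \<Longrightarrow> F i \<succeq>\<^sub>q G i) \<Longrightarrow> (\<Sum>i\<in>S. F i) \<succeq>\<^sub>q (\<Sum>i\<in>S. G i)"
  by (simp add: coeff_ge_iff fps_sum_nth sum_mono)

lemma coeff_nonneg_mult [simp]: "F \<succeq>\<^sub>q 0 \<Longrightarrow> G \<succeq>\<^sub>q 0 \<Longrightarrow> F * G \<succeq>\<^sub>q 0"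
  by (simp add: coeff_ge_iff fps_mult_nth sum_nonneg)

lemma coeff_nonneg_prod: "(\<And>i. i \<in> S \<Longrightarrow> F i \<succeq>\<^sub>q 0) \<Longrightarrow> (\<Prod>i\<in>S. F i) \<succeq>\<^sub>q 0"
proof (induction S rule: infinite_finite_induct)
  case (insert i S)
  then show ?case by (simp add: coeff_nonneg_mult)
qed (simp_all add: coeff_ge_iff)

lemma coeff_ge_mult_left: "H \<succeq>\<^sub>q 0 \<Longrightarrow> F \<succeq>\<^sub>q G \<Longrightarrow> H * F \<succeq>\<^sub>q H * G"
  using coeff_nonneg_mult[of H "F - G"] coeff_ge_diff by (metis right_diff_distrib)

lemma coeff_ge_mult:
  assumes "F \<succeq>\<^sub>q G" "F' \<succeq>\<^sub>q G'" "F' \<succeq>\<^sub>q 0" "G \<succeq>\<^sub>q 0"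
  shows "F * F' \<succeq>\<^sub>q G * G'"
  using coeff_ge_mult_left[OF assms(3,1)] coeff_ge_mult_left[OF assms(4,2)]
  by (metis coeff_ge_trans mult.commute)

lemma coeff_nonneg_X_power [simp]: "fps_X ^ n \<succeq>\<^sub>q 0"
  by (simp add: coeff_ge_iff fps_X_power_nth)

lemma coeff_nonneg_X [simp]: "fps_X \<succeq>\<^sub>q 0"
  using coeff_nonneg_X_power[of 1] by simp

lemma coeff_nonneg_1 [simp]: "1 \<succeq>\<^sub>q 0"
  using coeff_nonneg_X_power[of 0] by simp

lemma coeff_nonneg_power [simp]: "F \<succeq>\<^sub>q 0 \<Longrightarrow> F ^ n \<succeq>\<^sub>q 0"
  by (induction n) simp_all

lemma coeff_nonneg_numeral [simp]: "numeral n \<succeq>\<^sub>q 0"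
  by (simp add: coeff_ge_iff fps_numeral_nth)

section \<open>Geometric series\<close>

text \<open>This is 1/(1 - q^a) for a > 0; \<open>geo 0\<close> is 1, as 0 divides only 0.\<close>

definition geo :: "nat \<Rightarrow> rat fps" where
  "geo a = Abs_fps (\<lambda>n. if a dvd n then 1 else 0)"

lemma coeff_nonneg_geo [simp]: "geo a \<succeq>\<^sub>q 0"
  by (simp add: coeff_ge_iff geo_def)

lemma geo_ge_1 [simp]: "geo a \<succeq>\<^sub>q 1"
  by (simp add: coeff_ge_iff geo_def)

lemma geo_inverse:
  assumes "a > 0"
  shows "(1 - fps_X ^ a) * geo a = 1"
proof (rule fps_ext)
  fix n
  show "fps_nth ((1 - fps_X ^ a) * geo a) n = fps_nth 1 n"
    using assms by (auto simp: left_diff_distrib fps_X_power_mult_nth geo_def dvd_minus_self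
        dest: dvd_imp_le)
qed

text \<open>The product is the finite geometric sum 1 + q + ... + q^(a-1).\<close>

lemma one_minus_X_power_geo: "(1 - fps_X ^ a) * geo 1 \<succeq>\<^sub>q 0"
proof -
  have "1 - fps_X ^ a = (1 - fps_X) * (\<Sum>i<a. fps_X ^ i :: rat fps)"
    by (rule one_diff_power_eq)
  then have "(1 - fps_X ^ a) * geo 1 = (\<Sum>i<a. fps_X ^ i)"
    using geo_inverse[of 1] by (simp add: mult.commute mult.left_commute)
  then show ?thesis by (simp add: coeff_ge_iff fps_sum_nth sum_nonneg fps_X_power_nth)
qed

section \<open>Comparison of partial sums\<close>

text \<open>Multiplication by \<open>geo 1\<close> turns coefficients into their partial sums. This
  weaker order suffices wherever a factor 1/(1 - q) can be set aside.\<close>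

definition cum_ge :: "rat fps \<Rightarrow> rat fps \<Rightarrow> bool" where
  "cum_ge F G \<longleftrightarrow> geo 1 * F \<succeq>\<^sub>q geo 1 * G"

lemma cum_ge_diff: "cum_ge F G \<longleftrightarrow> (F - G) * geo 1 \<succeq>\<^sub>q 0"
  unfolding cum_ge_def by (subst coeff_ge_diff) (simp add: algebra_simps)

lemma cum_ge_of_coeff_ge: "F \<succeq>\<^sub>q G \<Longrightarrow> cum_ge F G"
  unfolding cum_ge_def by (intro coeff_ge_mult_left) simp_all

lemma cum_ge_trans [trans]: "cum_ge F G \<Longrightarrow> cum_ge G H \<Longrightarrow> cum_ge F H"
  unfolding cum_ge_def by (rule coeff_ge_trans)

lemma cum_ge_add: "cum_ge F G \<Longrightarrow> cum_ge F' G' \<Longrightarrow> cum_ge (F + F') (G + G')"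
  unfolding cum_ge_def distrib_left by (rule coeff_ge_add)

lemma cum_ge_mult_left: "H \<succeq>\<^sub>q 0 \<Longrightarrow> cum_ge F G \<Longrightarrow> cum_ge (H * F) (H * G)"
  unfolding cum_ge_def by (metis coeff_ge_mult_left mult.left_commute)

lemma cum_ge_mult:
  assumes "cum_ge F G" "cum_ge F' G'" "F' \<succeq>\<^sub>q 0" "G \<succeq>\<^sub>q 0"
  shows "cum_ge (F * F') (G * G')"
  using cum_ge_mult_left[OF assms(3,1)] cum_ge_mult_left[OF assms(4,2)]
  by (metis cum_ge_trans mult.commute)

lemma cum_ge_X_power:
  assumes "a \<le> b"
  shows "cum_ge (fps_X ^ a) (fps_X ^ b)"
proof -
  obtain c where "b = a + c" using assms le_Suc_ex by blast
  then have "fps_X ^ a - fps_X ^ b = fps_X ^ a * (1 - fps_X ^ c :: rat fps)"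
    by (simp add: power_add algebra_simps)
  then show ?thesis
    using coeff_nonneg_mult[OF coeff_nonneg_X_power one_minus_X_power_geo, of a c]
    by (simp add: cum_ge_diff mult.assoc)
qed

text \<open>The identity 1/(1 - u) - 1/(1 - v) = (u - v)/((1 - u)(1 - v)) reduces this to
  monomials.\<close>

lemma cum_ge_geo:
  assumes "0 < a" "a \<le> b"
  shows "cum_ge (geo a) (geo b)"
proof -
  have "(1 - fps_X ^ a) * geo a = 1" "(1 - fps_X ^ b) * geo b = 1"
    using assms by (auto intro: geo_inverse)
  moreover have "g - h = g * h * (u - v)" if "(1 - u) * g = 1" "(1 - v) * h = 1"
    for g h u v :: "rat fps" using that by algebra
  ultimately have "geo a - geo b = (geo a * geo b) * (fps_X ^ a - fps_X ^ b)" by blast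
  moreover have "cum_ge (geo a * geo b * fps_X ^ a) (geo a * geo b * fps_X ^ b)"
    by (intro cum_ge_mult_left coeff_nonneg_mult cum_ge_X_power assms) simp_all
  ultimately show ?thesis by (simp add: cum_ge_diff right_diff_distrib)
qed

section \<open>The reciprocals 1/(q;q)_n\<close>

definition pinv :: "nat \<Rightarrow> rat fps" where
  "pinv n = (\<Prod>j\<in>{1..n}. geo j)"

lemma pinv_0 [simp]: "pinv 0 = 1"
  by (simp add: pinv_def)

lemma pinv_Suc: "pinv (Suc n) = pinv n * geo (Suc n)"
  by (simp add: pinv_def)

lemma pinv_Suc_Suc: "pinv (n + 2) = pinv n * geo (n + 1) * geo (n + 2)"
  using pinv_Suc[of n] pinv_Suc[of "Suc n"] by simp

lemma coeff_nonneg_pinv [simp]: "pinv n \<succeq>\<^sub>q 0"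
  unfolding pinv_def by (intro coeff_nonneg_prod) simp

text \<open>Splits off chosen denominators, mostly 1/(1 - q), with a cofactor that stays
  nonnegative.\<close>

lemma pinv_factor:
  assumes "S \<subseteq> {1..n}"
  obtains R where "R \<succeq>\<^sub>q 0" "pinv n = (\<Prod>j\<in>S. geo j) * R"
proof
  show "(\<Prod>j\<in>{1..n} - S. geo j) \<succeq>\<^sub>q 0" by (intro coeff_nonneg_prod) simp
  show "pinv n = (\<Prod>j\<in>S. geo j) * (\<Prod>j\<in>{1..n} - S. geo j)"
    unfolding pinv_def by (subst prod.subset_diff[OF assms]) (simp_all add: mult.commute)
qed

lemma pinv_mono:
  assumes "m \<le> n"
  shows "pinv n \<succeq>\<^sub>q pinv m"
  using assms
proof (induction rule: dec_induct)
  case (step n)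
  have "pinv n * geo (Suc n) \<succeq>\<^sub>q pinv n * 1"
    by (intro coeff_ge_mult_left) simp_all
  with step show ?case unfolding pinv_Suc by (metis coeff_ge_trans mult_1_right)
qed simp

section \<open>The key inequality for small k - 2e\<close>

text \<open>Both factors on the left are lowered to 1/(1 - B), and 1/(1 - Y) on the right is cut by
  exponents modulo 3. Six pieces on each side are then matched one by one.\<close>

lemma cum_ge_geo_pair:
  assumes "f \<ge> 1" "K \<le> 2 * f + 3"
  shows "cum_ge (geo (K + 1) * geo (K + 2)) (fps_X ^ (3 * f + 3) * geo (2 * f + 1))"
proof -
  define b w where "b = 2 * f + 5" and "w = 2 * f + 1"
  define B Y Z where "B = (fps_X ^ b :: rat fps)" and "Y = (fps_X ^ w :: rat fps)"
    and "Z = (fps_X ^ (3 * f + 3) :: rat fps)"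
  define g where "g = geo b"
  define h where "h = geo (3 * w)"
  have b: "(1 - B) * g = 1" and Y: "(1 - Y) * geo w = 1" and Y3: "(1 - fps_X ^ (3 * w)) * h = 1"
    unfolding B_def Y_def g_def h_def by (rule geo_inverse; simp add: b_def w_def)+
  have "fps_X ^ (3 * w) = Y ^ 3" by (simp add: Y_def mult.commute flip: power_mult)
  then have Y3: "(1 - Y ^ 3) * h = 1" using Y3 by simp
  have nn: "B \<succeq>\<^sub>q 0" "g \<succeq>\<^sub>q 0" "h \<succeq>\<^sub>q 0" by (simp_all add: B_def g_def h_def)
  \<comment> \<open>The expansion of 1/(1 - B)^2; its tail B^3/(1 - B)^2 is dropped below.\<close>
  have gg: "g * g = 1 + 2 * B + 3 * B^2 * g + B^3 * g * g" if "(1 - B) * g = 1" for g B :: "rat fps"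
    using that by algebra
  have *: "k = (1 + Y + Y^2) + Y^3 * (1 + Y + Y^2) * h"
    if "(1 - Y) * k = 1" "(1 - Y ^ 3) * h = 1" for k h Y :: "rat fps"
    using that by algebra
  have "cum_ge (geo (K + 1) * geo (K + 2)) (g * g)"
    unfolding g_def using assms by (intro cum_ge_mult cum_ge_geo) (simp_all add: b_def)
  also have "cum_ge (g * g) (1 + (B + B) + (B^2 * g + (B^2 * g + B^2 * g)))"
  proof (rule cum_ge_of_coeff_ge)
    have eq: "g * g = (1 + (B + B) + (B^2 * g + (B^2 * g + B^2 * g))) + B^3 * g * g"
      using gg[OF b] by (simp add: algebra_simps)
    show "g * g \<succeq>\<^sub>q 1 + (B + B) + (B^2 * g + (B^2 * g + B^2 * g))"
      unfolding eq B_def power_mult[symmetric]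
      by (intro coeff_ge_add_nonneg coeff_nonneg_mult nn) simp
  qed
  also have "cum_ge \<dots> (Z + (Z * Y + Z * Y^2) + (Z * Y^3 * h + (Z * Y^4 * h + Z * Y^5 * h)))"
  proof -
    have 1: "cum_ge 1 Z" unfolding Z_def using cum_ge_X_power[of 0] by simp
    have 2: "cum_ge B (Z * Y)" "cum_ge B (Z * Y^2)"
      unfolding Z_def Y_def B_def power_mult[symmetric] power_add[symmetric]
      using assms by (auto intro!: cum_ge_X_power simp: b_def w_def)
    have 3: "cum_ge (B^2 * g) (Z * Y^j * h)" if "j \<ge> 3" for j
      unfolding g_def h_def
    proof (intro cum_ge_mult cum_ge_geo)
      have "3 * w \<le> w * j" using that by (simp add: mult.commute)
      then have "b * 2 \<le> 3 * f + 3 + w * j" using assms by (simp add: b_def w_def)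
      then show "cum_ge (B^2) (Z * Y^j)"
        unfolding Z_def Y_def B_def power_mult[symmetric] power_add[symmetric]
        by (rule cum_ge_X_power)
      show "Z * Y ^ j \<succeq>\<^sub>q 0"
        unfolding Z_def Y_def by (simp flip: power_mult power_add)
    qed (use assms in \<open>simp_all add: b_def w_def\<close>)
    show ?thesis by (intro cum_ge_add 1 2 3) simp_all
  qed
  also have "\<dots> = Z * geo w"
    using *[OF Y Y3] by (simp add: algebra_simps eval_nat_numeral)
  finally show ?thesis by (simp add: Z_def w_def)
qed

text \<open>
  The key inequality for \<open>e = f + 1\<close> and \<open>K = k - 2e\<close>, divided by \<open>q\<^bsup>2f(f+1)\<^esup>\<close>; the term
  \<open>t\<^bsub>e+1\<^esub>\<close> is dropped here and kept, with \<open>K + 2\<close> in place of \<open>K\<close>, in \<open>pinv_ge_many\<close>.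
\<close>

lemma pinv_ge_few:
  assumes "f \<ge> 1" "K \<le> 2 * f + 3"
  shows "pinv (2 * f) * pinv (K + 2) \<succeq>\<^sub>q
    fps_X ^ (3 * f + 3) * (1 - fps_X ^ (f + 1)) * pinv (2 * f + 2) * pinv K"
proof -
  obtain R where R: "R \<succeq>\<^sub>q 0" "pinv (2 * f) = geo 1 * R"
    using pinv_factor[of "{1}" "2 * f"] assms by auto
  define z where "z = (fps_X ^ (f + 1) :: rat fps)"
  define g where "g = geo (2 * f + 2)"
  have "(1 - fps_X ^ (2 * f + 2)) * g = 1" unfolding g_def by (rule geo_inverse) simp
  moreover have "z ^ 2 = fps_X ^ ((f + 1) * 2)" unfolding z_def by (rule power_mult[symmetric])
  ultimately have zg: "(1 - z ^ 2) * g = 1" by (simp add: mult.commute)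
  \<comment> \<open>Here (1 - z) g is 1/(1 + z) = 1 - z + z^2 - ..., whose partial sums are only 0
    and 1.\<close>
  have "1 - (1 - z) * g = z * g * (1 - z)" if "(1 - z ^ 2) * g = 1" for z g :: "rat fps"
    using that by algebra
  from this[OF zg] have "(1 - (1 - z) * g) * geo 1 = z * g * ((1 - z) * geo 1)"
    by (simp only: mult.assoc)
  moreover have "\<dots> \<succeq>\<^sub>q 0"
    unfolding z_def g_def
    by (rule coeff_nonneg_mult[OF coeff_nonneg_mult one_minus_X_power_geo])
       (simp_all only: coeff_nonneg_X_power coeff_nonneg_geo)
  ultimately have half: "cum_ge 1 ((1 - z) * g)" by (simp only: cum_ge_diff)
  have "cum_ge (geo (K + 1) * geo (K + 2)) (fps_X ^ (3 * f + 3) * geo (2 * f + 1))"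
    using assms by (rule cum_ge_geo_pair)
  also have "cum_ge \<dots> (fps_X ^ (3 * f + 3) * geo (2 * f + 1) * ((1 - z) * g))"
    using cum_ge_mult_left[OF _ half, of "fps_X ^ (3 * f + 3) * geo (2 * f + 1)"]
    by (simp add: coeff_nonneg_mult)
  finally have "geo 1 * (geo (K + 1) * geo (K + 2)) \<succeq>\<^sub>q
      geo 1 * (fps_X ^ (3 * f + 3) * geo (2 * f + 1) * ((1 - z) * g))"
    unfolding cum_ge_def .
  then have "R * pinv K * (geo 1 * (geo (K + 1) * geo (K + 2))) \<succeq>\<^sub>q
      R * pinv K * (geo 1 * (fps_X ^ (3 * f + 3) * geo (2 * f + 1) * ((1 - z) * g)))"
    using R by (intro coeff_ge_mult_left[of "R * pinv K"]) simp_all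
  then show ?thesis
    unfolding pinv_Suc_Suc R(2) z_def[symmetric] g_def[symmetric] by (simp add: ac_simps)
qed

text \<open>
  Division with remainder by \<open>(1 - x)\<^sup>2\<close> and then by \<open>1 - x\<^sup>2\<close>; the exponent \<open>39\<close> makes the
  difference of both sides vanish to second order at \<open>x = 1\<close>.
\<close>

lemma bracket_2_identity:
  fixes x :: "rat fps"
  shows "1 + x^2 + x^22 * (1 + x^2 + x^3 + x^4) - x^6 * (1 + x^3 + x^6 + x^9 + x^12) =
    x^39 + (1 - x) * (1 - x) * (9 * x^36 + 8 * x^37 + (1 - x^2) *
      (1 + 2 * x + 5 * x^2 + 8 * x^3 + 13 * x^4 + 18 * x^5 + 24 * x^6 + 30 * x^7 + 37 *
      x^8 + 43 * x^9 + 50 * x^10 + 56 * x^11 + 62 * x^12 + 67 * x^13 + 72 * x^14 + 75 *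
      x^15 + 78 * x^16 + 79 * x^17 + 79 * x^18 + 77 * x^19 + 74 * x^20 + 69 * x^21 + 64 *
      x^22 + 57 * x^23 + 51 * x^24 + 44 * x^25 + 39 * x^26 + 33 * x^27 + 29 * x^28 + 24 *
      x^29 + 21 * x^30 + 17 * x^31 + 15 * x^32 + 12 * x^33 + 11 * x^34 + 9 * x^35))"
  by algebra

section \<open>Second partial sums and the bracket\<close>

lemma geo_X_power_diff: "a \<le> b \<Longrightarrow> geo 1 * (fps_X ^ a - fps_X ^ b) \<succeq>\<^sub>q 0"
  using cum_ge_X_power[of a b] by (simp add: cum_ge_diff mult.commute)

text \<open>One \<open>geo 1\<close> turns q^s (1 - q^a) into a window of a ones starting at s; the
  other takes partial sums. An earlier window that is at least as long dominates.\<close>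

lemma geo_window_diff:
  assumes "b \<le> a" "s \<le> t"
  shows "geo 1 * geo 1 * (fps_X ^ s * (1 - fps_X ^ a) - fps_X ^ t * (1 - fps_X ^ b)) \<succeq>\<^sub>q 0"
proof -
  obtain c d where a: "a = b + c" and t: "t = s + d"
    using assms le_Suc_ex by blast
  have "geo 1 * geo 1 * (fps_X ^ s * (1 - fps_X ^ a) - fps_X ^ t * (1 - fps_X ^ b)) =
      fps_X ^ s * ((1 - fps_X ^ b) * geo 1) * ((1 - fps_X ^ d) * geo 1) +
      fps_X ^ (s + b) * geo 1 * ((1 - fps_X ^ c) * geo 1)"
    unfolding a t by (simp add: power_add algebra_simps)
  moreover have "\<dots> \<succeq>\<^sub>q 0"
    by (intro coeff_nonneg_add coeff_nonneg_mult one_minus_X_power_geo) simp_all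
  ultimately show ?thesis by (simp only:)
qed

text \<open>
  With \<open>e = f + 1\<close>, the bracket is
  \<open>(1 - z)\<^bsup>-1\<^esup> (1 - q\<^bsup>2e-1\<^esup>)\<^bsup>-1\<^esup> ((1 - q\<^bsup>2e-1\<^esup>)(1 - z\<^sup>2) - z\<^sup>3 (1 - z) + q\<^sup>4 z\<^sup>8)\<close>, the
  \<open>k\<close>-independent form of \<open>t\<^bsub>e-1\<^esub> + t\<^bsub>e+1\<^esub> - c\<^bsub>2e\<^esub> (1 - q\<^sup>e)\<close>. For \<open>e \<ge> 3\<close> its second partial sums are
  nonnegative because each negative window of coefficients is matched with an earlier positive
  one that is at least as long; for \<open>e = 2\<close> this fails and one more factor \<open>1/(1 - q\<^sup>2)\<close> is needed.
\<close>

lemma bracket_nonneg_large: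
  assumes "f \<ge> 3"
  defines "x \<equiv> fps_X" and "z \<equiv> fps_X ^ (f + 1)"
    and "g \<equiv> geo (f + 1)" and "h \<equiv> geo (2 * f + 1)"
  shows "geo 1 * geo 1 * (1 + z - z^3 * h + x^4 * z^8 * g * h) \<succeq>\<^sub>q 0"
proof -
  define y :: "rat fps" where "y = fps_X ^ (2 * f + 1)"
  have "(1 - z) * g = 1" "(1 - y) * h = 1"
    unfolding z_def y_def g_def h_def by (rule geo_inverse; simp)+
  moreover have "1 + z - z^3 * h + x^4 * z^8 * g * h =
      (1 + z + x^4 * z^9 + x^4 * z^10 - z^3 - z^3 * y - z^3 * y^2 - z^3 * y^3)
      + (x^4 * z^8 - z^3 * y^4) * h + x^4 * z^9 * (h - 1) + x^4 * z^10 * (g * h - 1)"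
    if "(1 - z) * g = 1" "(1 - y) * h = 1" for x y z g h :: "rat fps"
    using that by algebra
  ultimately have E: "1 + z - z^3 * h + x^4 * z^8 * g * h =
      (1 + z + x^4 * z^9 + x^4 * z^10 - z^3 - z^3 * y - z^3 * y^2 - z^3 * y^3)
      + (x^4 * z^8 - z^3 * y^4) * h + x^4 * z^9 * (h - 1) + x^4 * z^10 * (g * h - 1)"
    by blast
  have xz: "x^i * z^j = fps_X ^ (i + (f + 1) * j)" and zy: "z^i * y^j = fps_X ^ ((f + 1) * i + (2 * f + 1) * j)"
    for i j unfolding x_def y_def z_def by (simp_all only: power_add power_mult)
  let ?w = "\<lambda>s a. fps_X ^ s * (1 - fps_X ^ a) :: rat fps"
  have V: "1 + z + x^4 * z^9 + x^4 * z^10 - z^3 - z^3 * y - z^3 * y^2 - z^3 * y^3 =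
      (?w 0 (3 * f + 3) - ?w (9 * f + 6) (f + 8)) + (?w (f + 1) (4 * f + 3) - ?w (7 * f + 5) (2 * f + 8))"
    using zy[of 3 0] zy[of 3 1] zy[of 3 2] zy[of 3 3]
    unfolding xz by (simp add: z_def algebra_simps flip: power_add power_Suc power_Suc2)
  have h1: "h - 1 \<succeq>\<^sub>q 0" "g * h - 1 \<succeq>\<^sub>q 0"
    unfolding coeff_ge_diff[symmetric] using coeff_ge_mult[of g 1 h 1]
    by (simp_all add: g_def h_def)
  define D where "D = geo 1 * (x^4 * z^8 - z^3 * y^4)"
  have D: "D \<succeq>\<^sub>q 0"
    unfolding D_def xz zy by (rule geo_X_power_diff) (use assms in simp)
  have "geo 1 * geo 1 * (1 + z - z^3 * h + x^4 * z^8 * g * h) =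
      geo 1 * geo 1 * (?w 0 (3 * f + 3) - ?w (9 * f + 6) (f + 8))
      + geo 1 * geo 1 * (?w (f + 1) (4 * f + 3) - ?w (7 * f + 5) (2 * f + 8))
      + geo 1 * D * h
      + geo 1 * geo 1 * (x^4 * z^9) * (h - 1) + geo 1 * geo 1 * (x^4 * z^10) * (g * h - 1)"
    unfolding E V D_def by (simp only: distrib_left mult.assoc)
  also have "\<dots> \<succeq>\<^sub>q 0"
  proof (intro coeff_nonneg_add)
    \<comment> \<open>The length conditions f + 8 <= 3f + 3 and 2f + 8 <= 4f + 3 both require f >=
      3.\<close>
    show "geo 1 * geo 1 * (?w 0 (3 * f + 3) - ?w (9 * f + 6) (f + 8)) \<succeq>\<^sub>q 0"
      "geo 1 * geo 1 * (?w (f + 1) (4 * f + 3) - ?w (7 * f + 5) (2 * f + 8)) \<succeq>\<^sub>q 0"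
      using assms by (intro geo_window_diff; simp)+
  qed (use D h1 in \<open>simp_all add: x_def z_def g_def h_def\<close>)
  finally show ?thesis .
qed

text \<open>At f = 2 the negative windows of the general argument are one too long (10 against 9, 12
  against 11). The expansions are carried further and the positive window from 3 to 14 is split at
  10, which gives three matching pairs.\<close>

lemma bracket_nonneg_3:
  defines "x \<equiv> fps_X" and "g \<equiv> geo 3" and "h \<equiv> geo 5"
  shows "geo 1 * geo 1 * (1 + x^3 - x^9 * h + x^28 * g * h) \<succeq>\<^sub>q 0"
proof -
  let ?w = "\<lambda>s a. fps_X ^ s * (1 - fps_X ^ a) :: rat fps"
  have "(1 - x^3) * g = 1" "(1 - x^5) * h = 1"
    unfolding x_def g_def h_def by (rule geo_inverse; simp)+
  then have E: "1 + x^3 - x^9 * h + x^28 * g * h =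
      ((1 - x^9) - x^19 * (1 - x^9)) + (x^3 * (1 - x^7) - x^24 * (1 - x^7))
      + (x^10 * (1 - x^4) - x^29 * (1 - x^4))
      + x^10 * (x^28 - x^29) * h + x^31 * (h - 1) + x^34 * (g * h - 1)"
    by algebra
  have h1: "h - 1 \<succeq>\<^sub>q 0" "g * h - 1 \<succeq>\<^sub>q 0"
    unfolding coeff_ge_diff[symmetric] using coeff_ge_mult[of g 1 h 1]
    by (simp_all add: g_def h_def)
  have "geo 1 * geo 1 * (1 + x^3 - x^9 * h + x^28 * g * h) =
      geo 1 * geo 1 * (?w 0 9 - ?w 19 9) + geo 1 * geo 1 * (?w 3 7 - ?w 24 7)
      + geo 1 * geo 1 * (?w 10 4 - ?w 29 4)
      + geo 1 * x^10 * (geo 1 * (x^28 - x^29)) * h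
      + geo 1 * geo 1 * x^31 * (h - 1) + geo 1 * geo 1 * x^34 * (g * h - 1)"
    unfolding E unfolding x_def by (simp add: algebra_simps)
  also have "\<dots> \<succeq>\<^sub>q 0"
    unfolding x_def
    by (intro coeff_nonneg_add geo_window_diff geo_X_power_diff coeff_nonneg_mult h1)
       (simp_all add: h_def)
  finally show ?thesis .
qed

text \<open>The truncated part \<open>V\<close> is treated by the explicit division above: (1 - x)^2
  and 1 - x^2 cancel against \<open>geo 1 * geo 1 * geo 2\<close>, and only visibly nonnegative
  terms remain.\<close>

lemma bracket_nonneg_2:
  defines "x \<equiv> fps_X" and "g \<equiv> geo 2" and "h \<equiv> geo 3"
  shows "geo 1 * geo 1 * geo 2 * (1 + x^2 - x^6 * h + x^20 * g * h) \<succeq>\<^sub>q 0"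
proof -
  define V where "V = 1 + x^2 + x^22 * (1 + x^2 + x^3 + x^4) - x^6 * (1 + x^3 + x^6 + x^9 + x^12)"
  have gh: "(1 - x^2) * g = 1" "(1 - x^3) * h = 1"
    unfolding x_def g_def h_def by (rule geo_inverse; simp)+
  then have E: "1 + x^2 - x^6 * h + x^20 * g * h =
      V + (x^20 - x^21) * h + x^22 * (x^4 * (g - 1) + x^3 * (g * h - 1))"
    unfolding V_def by algebra
  have h1: "g - 1 \<succeq>\<^sub>q 0" "g * h - 1 \<succeq>\<^sub>q 0"
    unfolding coeff_ge_diff[symmetric] using coeff_ge_mult[of g 1 h 1]
    by (simp_all add: g_def h_def)
  define A where "A = 1 + 2 * x + 5 * x^2 + 8 * x^3 + 13 * x^4 + 18 * x^5 + 24 * x^6 + 30 * x^7 + 37 *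
      x^8 + 43 * x^9 + 50 * x^10 + 56 * x^11 + 62 * x^12 + 67 * x^13 + 72 * x^14 + 75 *
      x^15 + 78 * x^16 + 79 * x^17 + 79 * x^18 + 77 * x^19 + 74 * x^20 + 69 * x^21 + 64 *
      x^22 + 57 * x^23 + 51 * x^24 + 44 * x^25 + 39 * x^26 + 33 * x^27 + 29 * x^28 + 24 *
      x^29 + 21 * x^30 + 17 * x^31 + 15 * x^32 + 12 * x^33 + 11 * x^34 + 9 * x^35"
  have A: "A \<succeq>\<^sub>q 0"
    unfolding A_def x_def
    by (simp only: coeff_nonneg_add coeff_nonneg_mult coeff_nonneg_power coeff_nonneg_numeral
        coeff_nonneg_X coeff_nonneg_1)
  have "V = x^39 + (1 - x) * (1 - x) * (9 * x^36 + 8 * x^37 + (1 - x^2) * A)"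
    unfolding V_def A_def by (rule bracket_2_identity)
  moreover have "p * p * g * (M + (1 - x) * (1 - x) * (Q + (1 - x^2) * A)) =
      p * p * g * M + ((1 - x) * p) * ((1 - x) * p) * (Q * g + ((1 - x^2) * g) * A)"
    for p M Q :: "rat fps" by (simp only: distrib_left distrib_right ac_simps)
  moreover have "(1 - x) * geo 1 = 1"
    unfolding x_def using geo_inverse[of 1] by simp
  ultimately have VG: "geo 1 * geo 1 * g * V = geo 1 * geo 1 * g * x^39 + ((9 * x^36 + 8 * x^37) * g + A)"
    using gh(1) by (simp only: mult_1_left)
  have 98: "9 * x^36 + 8 * x^37 \<succeq>\<^sub>q 0"
    unfolding x_def
    by (simp only: coeff_nonneg_add coeff_nonneg_mult coeff_nonneg_power coeff_nonneg_numeral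
        coeff_nonneg_X)
  define D where "D = geo 1 * (x^20 - x^21)"
  have D: "D \<succeq>\<^sub>q 0" unfolding D_def x_def by (rule geo_X_power_diff) simp
  have "geo 1 * geo 1 * g * (1 + x^2 - x^6 * h + x^20 * g * h) =
      geo 1 * geo 1 * g * V + geo 1 * g * D * h
      + geo 1 * geo 1 * g * x^22 * (x^4 * (g - 1) + x^3 * (g * h - 1))"
    unfolding E D_def by (simp add: algebra_simps)
  also have "\<dots> = geo 1 * geo 1 * g * x^39 + (9 * x^36 + 8 * x^37) * g + A
      + geo 1 * g * D * h
      + geo 1 * geo 1 * g * x^22 * (x^4 * (g - 1) + x^3 * (g * h - 1))"
    unfolding VG by (simp only: add.assoc)
  also have "\<dots> \<succeq>\<^sub>q 0"
  proof (intro coeff_nonneg_add)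
    have nn: "x \<succeq>\<^sub>q 0" "g \<succeq>\<^sub>q 0" "h \<succeq>\<^sub>q 0" by (simp_all add: x_def g_def h_def)
    show "geo 1 * geo 1 * g * x ^ 39 \<succeq>\<^sub>q 0" "(9 * x ^ 36 + 8 * x ^ 37) * g \<succeq>\<^sub>q 0"
      "geo 1 * g * D * h \<succeq>\<^sub>q 0"
      "geo 1 * geo 1 * g * x^22 * (x^4 * (g - 1) + x^3 * (g * h - 1)) \<succeq>\<^sub>q 0"
      using nn D h1 98
      by (simp_all only: coeff_nonneg_mult coeff_nonneg_add coeff_nonneg_power coeff_nonneg_geo)
  qed (fact A)
  finally show ?thesis by (simp only: g_def)
qed

lemma bracket_nonneg:
  assumes "f \<ge> 1"
  defines "z \<equiv> fps_X ^ (f + 1)" and "g \<equiv> geo (f + 1)" and "h \<equiv> geo (2 * f + 1)"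
  shows "geo 1 * geo 1 * geo 2 * (1 + z - z^3 * h + fps_X^4 * z^8 * g * h) \<succeq>\<^sub>q 0"
proof -
  consider "f = 1" | "f = 2" | "f \<ge> 3" using assms by linarith
  then show ?thesis
  proof cases
    case 1
    have "z = fps_X^2" "z^3 = fps_X^6" "fps_X^4 * z^8 = fps_X^20" "g = geo 2" "h = geo 3"
      unfolding z_def g_def h_def 1 by (simp_all add: eval_nat_numeral)
    then show ?thesis using bracket_nonneg_2 by (simp only:)
  next
    case 2
    have "z = fps_X^3" "z^3 = fps_X^9" "fps_X^4 * z^8 = fps_X^28" "g = geo 3" "h = geo 5"
      unfolding z_def g_def h_def 2 by (simp_all add: eval_nat_numeral)
    then have "geo 2 * (geo 1 * geo 1 * (1 + z - z^3 * h + fps_X^4 * z^8 * g * h)) \<succeq>\<^sub>q 0"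
      using bracket_nonneg_3 by (simp only: coeff_nonneg_mult coeff_nonneg_geo)
    then show ?thesis by (simp only: ac_simps)
  next
    case 3
    have "geo 2 * (geo 1 * geo 1 * (1 + z - z^3 * h + fps_X^4 * z^8 * g * h)) \<succeq>\<^sub>q 0"
      unfolding z_def g_def h_def
      by (rule coeff_nonneg_mult[OF _ bracket_nonneg_large[OF 3]]) simp
    then show ?thesis by (simp only: ac_simps)
  qed
qed

section \<open>The key inequality for large k - 2e\<close>

text \<open>Here \<open>K + 2\<close> is k - 2e. After every product is brought to the common factor
  \<open>pinv (K + 2)\<close>, the difference is the bracket times a nonnegative series.\<close>

lemma pinv_ge_many:
  assumes "f \<ge> 1" "K \<ge> 2 * f + 2"
  shows "pinv (2 * f) * pinv (K + 4) + fps_X ^ (8 * f + 12) * pinv (2 * f + 4) * pinv K \<succeq>\<^sub>q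
    fps_X ^ (3 * f + 3) * (1 - fps_X ^ (f + 1)) * pinv (2 * f + 2) * pinv (K + 2)"
proof -
  define z g h u where "z = (fps_X ^ (f + 1) :: rat fps)" and "g = geo (f + 1)"
    and "h = geo (2 * f + 1)" and "u = geo (2 * f + 2)"
  define y :: "rat fps" where "y = fps_X ^ (2 * f + 1)"
  have "(1 - fps_X ^ (2 * f + 2)) * u = 1" unfolding u_def by (rule geo_inverse) simp
  moreover have "z ^ 2 = fps_X ^ ((f + 1) * 2)" unfolding z_def by (rule power_mult[symmetric])
  ultimately have u: "(1 - z ^ 2) * u = 1" by (simp add: mult.commute)
  have g: "(1 - z) * g = 1" "(1 - y) * h = 1"
    unfolding z_def y_def g_def h_def by (rule geo_inverse; simp)+
  have z8: "fps_X ^ (8 * f + 12) = fps_X ^ 4 * z ^ 8" and z3: "fps_X ^ (3 * f + 3) = z ^ 3"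
    unfolding z_def by (simp_all add: algebra_simps flip: power_mult power_add)
  obtain R where R: "R \<succeq>\<^sub>q 0" "pinv (2 * f) = geo 1 * geo 2 * R"
    using pinv_factor[of "{1, 2}" "2 * f"] assms by auto
  obtain S where S: "S \<succeq>\<^sub>q 0" "pinv (K + 2) = geo 1 * g * S"
    using pinv_factor[of "{1, f + 1}" "K + 2"] assms by (auto simp: g_def)
  \<comment> \<open>As 2f + 3 <= K + 1, the denominators with larger indices may replace the smaller
    ones under partial sums; this is the lower bound for c_(2e+2).\<close>
  have "geo 1 * (geo (2 * f + 3) * geo (2 * f + 4)) \<succeq>\<^sub>q geo 1 * (geo (K + 1) * geo (K + 2))"
    unfolding cum_ge_def[symmetric] using assms by (intro cum_ge_mult cum_ge_geo) simp_all
  moreover obtain T where T: "T \<succeq>\<^sub>q 0" "pinv K = geo 1 * T"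
    using pinv_factor[of "{1}" K] assms by auto
  ultimately have "pinv (2 * f + 2) * T * (geo 1 * (geo (2 * f + 3) * geo (2 * f + 4)))
      \<succeq>\<^sub>q pinv (2 * f + 2) * T * (geo 1 * (geo (K + 1) * geo (K + 2)))"
    by (intro coeff_ge_mult_left[of "pinv (2 * f + 2) * T"]) simp_all
  then have next_ge: "pinv (2 * f + 4) * pinv K \<succeq>\<^sub>q pinv (2 * f + 2) * pinv (K + 2)"
    using pinv_Suc_Suc[of "2 * f + 2"] pinv_Suc_Suc[of K] T(2)
    by (simp add: ac_simps numeral_eq_Suc)
  have "pinv (2 * f) * pinv (K + 4) + fps_X ^ (8 * f + 12) * (pinv (2 * f + 4) * pinv K) \<succeq>\<^sub>q
      pinv (2 * f) * pinv (K + 2) + fps_X ^ (8 * f + 12) * (pinv (2 * f + 2) * pinv (K + 2))"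
    by (intro coeff_ge_add coeff_ge_mult_left pinv_mono next_ge) simp_all
  also have "pinv (2 * f) * pinv (K + 2) + fps_X ^ (8 * f + 12) * (pinv (2 * f + 2) * pinv (K + 2)) =
      R * S * u * (geo 1 * geo 1 * geo 2 * (1 + z - z^3 * h + fps_X^4 * z^8 * g * h))
      + fps_X ^ (3 * f + 3) * (1 - fps_X ^ (f + 1)) * pinv (2 * f + 2) * pinv (K + 2)"
  proof -
    have p: "pinv (2 * f + 2) = geo 1 * geo 2 * R * h * u"
      unfolding pinv_Suc_Suc R(2) by (simp add: h_def u_def)
    \<comment> \<open>That is, 1/(1 - z) = (1 + z)/(1 - z^2); it makes \<open>u\<close> a common
      factor of all terms.\<close>
    have "g = u * (1 + z)" if "(1 - z) * g = 1" "(1 - z ^ 2) * u = 1" for g u z :: "rat fps"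
      using that by algebra
    from this[OF g(1) u] have "g - u * (1 + z) = 0" by simp
    then have "g + x * h * u * g - z ^ 3 * h * u * ((1 - z) * g) = u * (1 + z - z ^ 3 * h + x * g * h)" for x
      unfolding g(1) by (simp add: algebra_simps)
    from arg_cong[OF this[of "fps_X^4 * z^8"], of "\<lambda>t. geo 1 * geo 1 * geo 2 * R * S * t"]
    show ?thesis
      unfolding p S(2) R(2) z8 z3 z_def[symmetric] by (simp add: algebra_simps)
  qed
  also have "\<dots> \<succeq>\<^sub>q fps_X ^ (3 * f + 3) * (1 - fps_X ^ (f + 1)) * pinv (2 * f + 2) * pinv (K + 2)"
  proof -
    have "R * S * u * (geo 1 * geo 1 * geo 2 * (1 + z - z^3 * h + fps_X^4 * z^8 * g * h)) \<succeq>\<^sub>q 0"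
      unfolding z_def g_def h_def
      by (rule coeff_nonneg_mult[OF _ bracket_nonneg[OF assms(1)]]) (simp add: R(1) S(1) u_def)
    then show ?thesis using coeff_ge_add_nonneg by (metis add.commute)
  qed
  finally show ?thesis by (simp only: mult.assoc)
qed

section \<open>The terms c_i and their neighbours\<close>

text \<open>The value 0 beyond k lets a neighbour outside the range be written without a case
  distinction.\<close>

definition cterm :: "nat \<Rightarrow> nat \<Rightarrow> rat fps" where
  "cterm k i = (if i \<le> k then fps_X ^ (i * (i + 1) div 2) * pinv i * pinv (k - i) else 0)"

lemma coeff_nonneg_cterm [simp]: "cterm k i \<succeq>\<^sub>q 0"
  by (simp add: cterm_def)

text \<open>For i > 0 the factor 1/(1 - q) comes from \<open>pinv i\<close>; for i = 0 it comes from
  \<open>pinv k\<close>, where k >= 1 is needed.\<close>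

lemma cterm_factor:
  assumes "k \<ge> 1"
  obtains R where "R \<succeq>\<^sub>q 0" "cterm k i = geo 1 * R"
proof (cases "i \<le> k")
  case True
  show ?thesis
  proof (cases "i = 0")
    case True
    then show ?thesis
      using pinv_factor[of "{1}" k] assms that by (auto simp: cterm_def)
  next
    case False
    then obtain R where "R \<succeq>\<^sub>q 0" "pinv i = geo 1 * R"
      using pinv_factor[of "{1}" i] by auto
    then show ?thesis
      using that[of "fps_X ^ (i * (i + 1) div 2) * R * pinv (k - i)"] True
      by (simp add: cterm_def ac_simps)
  qed
next
  case False
  then show ?thesis using that[of 0] by (simp add: cterm_def)
qed

text \<open>The factor 1/(1 - q) makes the coefficients nondecreasing in the exponent, so a further
  shift can only lower them.\<close>

lemma cterm_antimono:
  assumes "k \<ge> 1" "a \<le> b"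
  shows "fps_X ^ a * cterm k i \<succeq>\<^sub>q fps_X ^ b * cterm k i"
proof -
  obtain R where R: "R \<succeq>\<^sub>q 0" "cterm k i = geo 1 * R" using cterm_factor[OF assms(1)] .
  have "R * (geo 1 * fps_X ^ a) \<succeq>\<^sub>q R * (geo 1 * fps_X ^ b)"
    using cum_ge_X_power[OF assms(2)] R(1) unfolding cum_ge_def by (intro coeff_ge_mult_left[of R])
  then show ?thesis unfolding R(2) by (simp only: ac_simps)
qed

text \<open>The key inequality for e = f + 1. Once the common power \<open>B\<close> is taken out,
  the size of K = k - 2e decides between \<open>pinv_ge_few\<close> and
  \<open>pinv_ge_many\<close>.\<close>

lemma cterm_neighbours_aux:
  assumes "f \<ge> 1" "2 * f + 2 \<le> k"
  shows "fps_X ^ f * cterm k (2 * f) + fps_X ^ (f + 2) * cterm k (2 * f + 4) \<succeq>\<^sub>q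
    (1 - fps_X ^ (f + 1)) * cterm k (2 * f + 2)"
proof -
  obtain K where k: "k = 2 * f + 2 + K" using assms le_Suc_ex by blast
  define B :: "rat fps" where "B = fps_X ^ (2 * f * (f + 1))"
  have c0: "fps_X ^ f * cterm k (2 * f) = B * (pinv (2 * f) * pinv (K + 2))"
  proof -
    have "f + 2 * f * (2 * f + 1) div 2 = 2 * f * (f + 1)" by (simp add: algebra_simps)
    then have x: "fps_X ^ f * fps_X ^ (2 * f * (2 * f + 1) div 2) = B"
      unfolding B_def by (simp only: power_add[symmetric])
    have c: "cterm k (2 * f) = fps_X ^ (2 * f * (2 * f + 1) div 2) * (pinv (2 * f) * pinv (K + 2))"
      unfolding cterm_def k by simp
    show ?thesis unfolding c mult.assoc[symmetric] x ..
  qed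
  have c1: "(1 - fps_X ^ (f + 1)) * cterm k (2 * f + 2) =
      B * (fps_X ^ (3 * f + 3) * (1 - fps_X ^ (f + 1)) * pinv (2 * f + 2) * pinv K)"
  proof -
    have "(2 * f + 2) * (2 * f + 2 + 1) div 2 = 2 * f * (f + 1) + (3 * f + 3)"
      by (simp add: algebra_simps)
    then have x: "fps_X ^ ((2 * f + 2) * (2 * f + 2 + 1) div 2) = B * fps_X ^ (3 * f + 3)"
      unfolding B_def by (simp only: power_add[symmetric])
    have c: "cterm k (2 * f + 2) =
        fps_X ^ ((2 * f + 2) * (2 * f + 2 + 1) div 2) * pinv (2 * f + 2) * pinv K"
      unfolding cterm_def k by simp
    show ?thesis unfolding c x by (simp only: ac_simps)
  qed
  show ?thesis
  proof (cases "K \<le> 2 * f + 3")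
    case True
    have "fps_X ^ f * cterm k (2 * f) + fps_X ^ (f + 2) * cterm k (2 * f + 4) \<succeq>\<^sub>q
        fps_X ^ f * cterm k (2 * f)"
      by (intro coeff_ge_add_nonneg) simp
    also have "\<dots> \<succeq>\<^sub>q (1 - fps_X ^ (f + 1)) * cterm k (2 * f + 2)"
      unfolding c0 c1 B_def
      by (intro coeff_ge_mult_left[of "fps_X ^ _"] pinv_ge_few assms True) simp
    finally show ?thesis .
  next
    case False
    then obtain L where "K = 2 + L" using le_Suc_ex[of 2 K] by auto
    then have K: "K = L + 2" "2 * f + 2 \<le> L" and K4: "K + 2 = L + 4" using False by simp_all
    \<comment> \<open>\<open>L\<close> is k - (2e + 2), the second index in c_(2e+2).\<close>
    have "(2 * f + 4) * (2 * f + 4 + 1) div 2 + (f + 2) = 2 * f * (f + 1) + (8 * f + 12)"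
      by (simp add: algebra_simps)
    then have x: "fps_X ^ ((2 * f + 4) * (2 * f + 4 + 1) div 2) * fps_X ^ (f + 2) = B * fps_X ^ (8 * f + 12)"
      unfolding B_def by (simp only: power_add[symmetric])
    have c: "cterm k (2 * f + 4) =
        fps_X ^ ((2 * f + 4) * (2 * f + 4 + 1) div 2) * (pinv (2 * f + 4) * pinv L)"
      unfolding cterm_def k K(1) by simp
    have "fps_X ^ (f + 2) * cterm k (2 * f + 4) =
        (fps_X ^ ((2 * f + 4) * (2 * f + 4 + 1) div 2) * fps_X ^ (f + 2)) * (pinv (2 * f + 4) * pinv L)"
      unfolding c by (simp only: ac_simps)
    then have c2: "fps_X ^ (f + 2) * cterm k (2 * f + 4) =
        B * (fps_X ^ (8 * f + 12) * pinv (2 * f + 4) * pinv L)"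
      unfolding x by (simp only: mult.assoc)
    show ?thesis
      unfolding c0 c1 c2 distrib_left[symmetric] B_def K4 unfolding K(1)
      by (rule coeff_ge_mult_left[OF _ pinv_ge_many[OF assms(1) K(2)]]) simp
  qed
qed

lemma cterm_neighbours:
  assumes "e \<ge> 2" "2 * e \<le> k"
  shows "fps_X ^ (e - 1) * cterm k (2 * (e - 1)) + fps_X ^ (e + 1) * cterm k (2 * (e + 1)) \<succeq>\<^sub>q
    (1 - fps_X ^ e) * cterm k (2 * e)"
proof -
  obtain f where f: "e = f + 1" using assms(1) by (intro that[of "e - 1"]) simp
  then have "e - 1 = f" "e + 1 = f + 2" "2 * (e + 1) = 2 * f + 4" "2 * e = 2 * f + 2" "f \<ge> 1"
    using assms(1) by simp_all
  then show ?thesis using cterm_neighbours_aux[of f k] assms(2) by (simp only: f)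
qed

section \<open>The two-neighbour bound for h = 2\<close>

text \<open>The exceptional case m = 1, k = 4, where (1 - q)^2 c_4 has a negative coefficient.
  Cancelling 1 - q and a common factor leaves \<open>geo 1 * geo 1 * geo 2\<close> against 2 q^7
  \<open>geo 3 * geo 4\<close>.\<close>

lemma cterm_4_4:
  "fps_X * cterm 4 2 + 2 * fps_X^2 * cterm 4 4 \<succeq>\<^sub>q 2 * fps_X * cterm 4 4"
proof -
  have g1: "(1 - fps_X) * geo 1 = 1" using geo_inverse[of 1] by simp
  have gg: "geo 1 * geo 1 \<succeq>\<^sub>q 2 * fps_X^7 * geo 3"
  proof -
    have "fps_nth (fps_X^7 * geo 3) n + fps_nth (fps_X^7 * geo 3) n \<le> (if n < 7 then 0 else 2)" for n
      unfolding fps_X_power_mult_nth by (simp add: geo_def)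
    moreover have "(if n < 7 then 0 else 2) \<le> fps_nth (geo 1 * geo 1) n" for n
      by (simp add: fps_mult_nth geo_def)
    ultimately show ?thesis
      unfolding coeff_ge_iff mult_2 distrib_right fps_add_nth by (blast intro: order_trans)
  qed
  have p2: "pinv 2 = geo 1 * geo 2" and p4: "pinv 4 = geo 1 * geo 2 * geo 3 * geo 4"
    using pinv_Suc_Suc[of 0] pinv_Suc_Suc[of 2] by (simp_all add: numeral_2_eq_2[symmetric])
  have c2: "cterm 4 2 = fps_X^3 * (geo 1 * geo 2) * (geo 1 * geo 2)"
    and c4: "cterm 4 4 = fps_X^10 * (geo 1 * geo 2 * geo 3 * geo 4)"
    unfolding cterm_def by (simp_all add: p2[simplified] p4[simplified])
  have "geo 2 \<succeq>\<^sub>q geo 4" by (auto simp: coeff_ge_iff geo_def intro: dvd_trans[of 2 4])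
  with gg have "geo 1 * geo 1 * geo 2 \<succeq>\<^sub>q 2 * fps_X^7 * geo 3 * geo 4"
    by (rule coeff_ge_mult) simp_all
  then have ge: "fps_X^4 * geo 2 * (geo 1 * geo 1 * geo 2) \<succeq>\<^sub>q fps_X^4 * geo 2 * (2 * fps_X^7 * geo 3 * geo 4)"
    by (intro coeff_ge_mult_left[of "fps_X^4 * geo 2"]) simp_all
  have l: "fps_X * cterm 4 2 = fps_X^4 * geo 2 * (geo 1 * geo 1 * geo 2)"
    unfolding c2 by (simp add: eval_nat_numeral ac_simps)
  have "2 * x * (x^10 * (p * a * b * c)) =
      x^4 * a * (2 * x^7 * b * c) + 2 * x^2 * (x^10 * (p * a * b * c))"
    if "(1 - x) * p = 1" for x p a b c :: "rat fps"
  proof -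
    have "2 * x * (x^10 * (p * a * b * c)) - 2 * x^2 * (x^10 * (p * a * b * c))
        = ((1 - x) * p) * (2 * x * x^10 * (a * b * c))"
      by (simp add: algebra_simps power2_eq_square)
    also have "\<dots> = x^4 * a * (2 * x^7 * b * c)"
      unfolding that by (simp add: eval_nat_numeral ac_simps)
    finally show ?thesis by (simp add: algebra_simps)
  qed
  from this[OF g1] have r: "2 * fps_X * cterm 4 4 =
      fps_X^4 * geo 2 * (2 * fps_X^7 * geo 3 * geo 4) + 2 * fps_X^2 * cterm 4 4"
    unfolding c4 .
  show ?thesis unfolding l r by (rule coeff_ge_add[OF ge coeff_ge_refl])
qed

text \<open>Each factor 1 - q^m is absorbed by its own denominator: one by 1/(1 - q), the other by
  1/(1 - q) from \<open>pinv (k - 4 * m)\<close> or, if k = 4m, by 1/(1 - q^m). In the latter case k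
  \<noteq> 4 makes the indices 1 and m distinct.\<close>

lemma cterm_one_minus_square:
  assumes "m \<ge> 1" "4 * m \<le> k" "k \<noteq> 4"
  shows "(1 - fps_X ^ m) * (1 - fps_X ^ m) * cterm k (4 * m) \<succeq>\<^sub>q 0"
proof -
  have "\<exists>a R. R \<succeq>\<^sub>q 0 \<and> cterm k (4 * m) = geo 1 * geo a * R \<and> (a = 1 \<or> a = m)"
  proof (cases "k = 4 * m")
    case True
    then obtain R where "R \<succeq>\<^sub>q 0" "pinv (4 * m) = geo 1 * geo m * R"
      using pinv_factor[of "{1, m}" "4 * m"] assms by auto
    then show ?thesis
      using True by (intro exI[of _ m] exI[of _ "fps_X ^ (4 * m * (4 * m + 1) div 2) * R"])
        (simp add: cterm_def ac_simps)
  next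
    case False
    obtain R where R: "R \<succeq>\<^sub>q 0" "pinv (4 * m) = geo 1 * R"
      using pinv_factor[of "{1}" "4 * m"] assms by auto
    have "1 \<le> k - 4 * m" using assms(2) False by linarith
    then obtain S where S: "S \<succeq>\<^sub>q 0" "pinv (k - 4 * m) = geo 1 * S"
      using pinv_factor[of "{1}" "k - 4 * m"] by auto
    from R S show ?thesis
      using assms by (intro exI[of _ 1] exI[of _ "fps_X ^ (4 * m * (4 * m + 1) div 2) * R * S"])
        (simp add: cterm_def ac_simps)
  qed
  then obtain a R where R: "R \<succeq>\<^sub>q 0" "cterm k (4 * m) = geo 1 * geo a * R" "a = 1 \<or> a = m" by blast
  have "(1 - fps_X ^ m) * geo a \<succeq>\<^sub>q 0"
    using R(3) one_minus_X_power_geo[of m] geo_inverse[of m] assms by auto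
  then have "((1 - fps_X ^ m) * geo 1) * ((1 - fps_X ^ m) * geo a) * R \<succeq>\<^sub>q 0"
    by (intro coeff_nonneg_mult[OF coeff_nonneg_mult[OF one_minus_X_power_geo]] R(1))
  then show ?thesis unfolding R(2) by (simp only: ac_simps)
qed

text \<open>The case e = 2m, doubled to clear the weight 1/2. Only A = 1 needs the neighbours; for A
  >= 2 the shift Am is at least 2m.\<close>

lemma cterm_two_neighbours:
  assumes "m \<ge> 1" "4 * m \<le> k" "A \<ge> 1"
  shows "fps_X ^ (2 * m - 1) * cterm k (2 * (2 * m - 1)) + fps_X ^ (2 * m + 1) * cterm k (2 * (2 * m + 1))
    + 2 * (fps_X ^ (2 * m) * cterm k (2 * (2 * m))) \<succeq>\<^sub>q 2 * (fps_X ^ (A * m) * cterm k (2 * (2 * m)))"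
    (is "?t + ?t' + 2 * (_ * ?c) \<succeq>\<^sub>q _")
proof (cases "A = 1")
  case False
  then have "2 * m \<le> A * m" using assms by simp
  then have "2 * (fps_X ^ (2 * m) * ?c) \<succeq>\<^sub>q 2 * (fps_X ^ (A * m) * ?c)"
    using assms by (intro coeff_ge_mult_left cterm_antimono) simp_all
  moreover have "?t + ?t' \<succeq>\<^sub>q 0" by simp
  ultimately show ?thesis using coeff_ge_add[of "?t + ?t'" 0] by simp
next
  case A: True
  show ?thesis
  proof (cases "k = 4")
    case True
    then have "m = 1" using assms by simp
    moreover have "cterm 4 6 = 0" by (simp add: cterm_def)
    ultimately show ?thesis using cterm_4_4 A True by (simp add: mult.assoc)
  next
    case False
    have "?t + ?t' \<succeq>\<^sub>q (1 - fps_X ^ (2 * m)) * ?c"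
      by (rule cterm_neighbours) (use assms in simp_all)
    then have "?t + ?t' + 2 * (fps_X ^ (2 * m) * ?c) \<succeq>\<^sub>q (1 - fps_X ^ (2 * m)) * ?c + 2 * (fps_X ^ (2 * m) * ?c)"
      by (intro coeff_ge_add coeff_ge_refl)
    also have "(1 - fps_X ^ (2 * m)) * ?c + 2 * (fps_X ^ (2 * m) * ?c) =
        2 * (fps_X ^ m * ?c) + (1 - fps_X ^ m) * (1 - fps_X ^ m) * ?c"
    proof -
      have "fps_X ^ (2 * m) = fps_X ^ m * (fps_X ^ m :: rat fps)" by (simp add: mult_2 power_add)
      then show ?thesis by (simp add: algebra_simps)
    qed
    also have "\<dots> \<succeq>\<^sub>q 2 * (fps_X ^ m * ?c)"
      using cterm_one_minus_square[OF assms(1,2) False] by (intro coeff_ge_add_nonneg) simp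
    finally show ?thesis using A by simp
  qed
qed

text \<open>Adding q^e c to (1 - q^e) c, where c = c_(2e), restores the unshifted c, which dominates
  all its shifts; hence \<open>a\<close> is arbitrary.\<close>

lemma cterm_neighbours_weak:
  assumes "e \<ge> 2" "2 * e \<le> k"
  shows "fps_X ^ (e - 1) * cterm k (2 * (e - 1)) + fps_X ^ (e + 1) * cterm k (2 * (e + 1))
    + fps_X ^ e * cterm k (2 * e) \<succeq>\<^sub>q fps_X ^ a * cterm k (2 * e)"
proof -
  have eq: "(1 - fps_X ^ e) * cterm k (2 * e) + fps_X ^ e * cterm k (2 * e) = fps_X ^ 0 * cterm k (2 * e)"
    by (simp add: algebra_simps)
  have "fps_X ^ 0 * cterm k (2 * e) \<succeq>\<^sub>q fps_X ^ a * cterm k (2 * e)"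
    using assms by (intro cterm_antimono) simp_all
  then show ?thesis
    using coeff_ge_trans[OF coeff_ge_add[OF cterm_neighbours[OF assms] coeff_ge_refl]] unfolding eq[symmetric]
    by blast
qed

section \<open>Summation over the multiples of h\<close>

definition eterm :: "nat \<Rightarrow> nat \<Rightarrow> rat fps" where
  "eterm k e = fps_X ^ e * cterm k (2 * e)"

text \<open>The predecessors \<open>P\<close> and successors \<open>Q\<close> of the multiples are
  not multiples themselves. For h >= 3 they also avoid each other; for h = 2 an index may lie in
  both, which the weight 1/2 compensates.\<close>

lemma sum_neighbours_le:
  fixes t :: "nat \<Rightarrow> rat"
  assumes h: "h \<ge> 2" and t: "\<And>e. t e \<ge> 0" and w: "w = (if h = 2 then 1 / 2 else 1)"
  shows "(\<Sum>e | e \<in> {1..n} \<and> h dvd e. t e + w * (t (e - 1) + t (e + 1))) \<le> (\<Sum>e\<in>{1..n+1}. t e)"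
proof -
  define S where "S = {e. e \<in> {1..n} \<and> h dvd e}"
  define P Q where "P = (\<lambda>e. e - 1) ` S" and "Q = (\<lambda>e. e + 1) ` S"
  have fin: "finite S" "finite P" "finite Q" by (simp_all add: S_def P_def Q_def)
  have S: "e \<ge> 2" "e \<le> n" "h dvd e" if "e \<in> S" for e
    using that h by (auto simp: S_def dest: dvd_imp_le)
  have P: "x \<ge> 1" "x \<le> n + 1" "h dvd x + 1" if x: "x \<in> P" for x
  proof -
    obtain e where "x = e - 1" "e \<in> S" using x unfolding P_def by blast
    then show "x \<ge> 1" "x \<le> n + 1" "h dvd x + 1" using S[of e] by simp_all
  qed
  have Q: "x \<ge> 1" "x \<le> n + 1" "h dvd x - 1" if x: "x \<in> Q" for x
  proof -
    obtain e where "x = e + 1" "e \<in> S" using x unfolding Q_def by blast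
    then show "x \<ge> 1" "x \<le> n + 1" "h dvd x - 1" using S[of e] by simp_all
  qed
  have sum_P: "(\<Sum>e\<in>S. t (e - 1)) = sum t P"
  proof -
    have "inj_on (\<lambda>e. e - 1) S"
    proof (rule inj_onI)
      fix e e' assume "e \<in> S" "e' \<in> S" "e - 1 = e' - 1"
      then show "e = e'" using S(1)[of e] S(1)[of e'] by linarith
    qed
    then show ?thesis by (simp add: P_def sum.reindex o_def)
  qed
  have sum_Q: "(\<Sum>e\<in>S. t (e + 1)) = sum t Q"
    by (simp add: Q_def sum.reindex o_def)
  have disj: "S \<inter> (P \<union> Q) = {}"
  proof -
    have False if "h dvd x" "h dvd x + 1" for x
      using that h by (metis dvd_add_right_iff nat_dvd_1_iff_1 numeral_le_one_iff semiring_norm(69))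
    then show ?thesis using S(3) P(3) Q(1,3) by (metis disjoint_iff UnE le_add_diff_inverse2)
  qed
  have "w * (sum t P + sum t Q) \<le> sum t (P \<union> Q)"
  proof (cases "h = 2")
    case True
    have "sum t P \<le> sum t (P \<union> Q)" "sum t Q \<le> sum t (P \<union> Q)"
      using fin t by (auto intro!: sum_mono2)
    then have "1 / 2 * (sum t P + sum t Q) \<le> sum t (P \<union> Q)" by (simp add: field_simps)
    then show ?thesis unfolding w if_P[OF True] .
  next
    case False
    have "x \<notin> Q" if "x \<in> P" for x
    proof
      assume "x \<in> Q"
      \<comment> \<open>A common element would make h divide the difference 2 of x + 1 and x -
        1.\<close>
      then have "(x - 1) + 2 = x + 1" using Q(1)[of x] by linarith
      then have "h dvd (x - 1) + 2" using P(3)[OF that] by (simp only:)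
      then have "h dvd 2" using Q(3)[OF \<open>x \<in> Q\<close>] by (metis dvd_add_right_iff)
      then show False using False h by (auto dest: dvd_imp_le)
    qed
    then have "P \<inter> Q = {}" by blast
    then show ?thesis using False w fin by (simp add: sum.union_disjoint)
  qed
  then have "(\<Sum>e\<in>S. t e + w * (t (e - 1) + t (e + 1))) \<le> sum t S + sum t (P \<union> Q)"
    unfolding sum.distrib sum_distrib_left[symmetric] sum_P sum_Q by simp
  also have "\<dots> = sum t (S \<union> (P \<union> Q))"
    using disj fin by (simp add: sum.union_disjoint)
  also have "\<dots> \<le> (\<Sum>e\<in>{1..n+1}. t e)"
    by (intro sum_mono2 t) (use P Q in \<open>auto simp: S_def\<close>)
  finally show ?thesis by (simp add: S_def)
qed

lemma eterm_bound:
  assumes "h \<ge> 2" "A \<ge> 1" "e \<ge> 1" "h dvd e" "w = (if h = 2 then 1 / 2 else 1)"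
  shows "fps_nth (fps_X ^ (A * (e div h)) * cterm k (2 * e)) n \<le>
    fps_nth (eterm k e) n + w * (fps_nth (eterm k (e - 1)) n + fps_nth (eterm k (e + 1)) n)"
proof (cases "2 * e \<le> k")
  case False
  then have "cterm k (2 * e) = 0" by (simp add: cterm_def)
  moreover have "fps_nth (eterm k i) n \<ge> 0" for i
  proof -
    have "eterm k i \<succeq>\<^sub>q 0" by (simp add: eterm_def)
    then show ?thesis by (simp add: coeff_ge_iff)
  qed
  ultimately show ?thesis using assms(5) by simp
next
  case True
  obtain m where m: "e = h * m" using assms(4) by blast
  then have "m \<ge> 1" using assms(3) by (cases m) auto
  show ?thesis
  proof (cases "h = 2")
    case True
    have "eterm k (e - 1) + eterm k (e + 1) + 2 * eterm k e \<succeq>\<^sub>q 2 * (fps_X ^ (A * (e div h)) * cterm k (2 * e))"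
      using cterm_two_neighbours[of m k A] \<open>m \<ge> 1\<close> \<open>2 * e \<le> k\<close> assms(2) True
      by (simp add: eterm_def m)
    then have "2 * fps_nth (fps_X ^ (A * (e div h)) * cterm k (2 * e)) n \<le>
        fps_nth (eterm k (e - 1)) n + fps_nth (eterm k (e + 1)) n + 2 * fps_nth (eterm k e) n"
      unfolding coeff_ge_iff mult_2[of "_ :: rat fps"] fps_add_nth mult_2[of "_ :: rat"] by blast
    moreover have "x \<le> t + 1 / 2 * (a + b)" if "2 * x \<le> a + b + 2 * t" for x t a b :: rat
      using that by (simp add: field_simps)
    ultimately show ?thesis unfolding assms(5) if_P[OF True] by blast
  next
    case False
    have "e \<ge> 2" using assms(1,3,4) by (auto dest: dvd_imp_le)
    from cterm_neighbours_weak[OF this \<open>2 * e \<le> k\<close>]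
    show ?thesis using False assms(5) unfolding coeff_ge_iff fps_add_nth eterm_def
      by (simp add: add.commute)
  qed
qed

lemma sum_eterm_ge:
  assumes "h \<ge> 1" "A \<ge> 1" "k \<ge> 1"
  shows "(\<Sum>e\<le>k. eterm k e) \<succeq>\<^sub>q
    (\<Sum>e\<le>k. if h dvd e then fps_X ^ (A * (e div h)) * cterm k (2 * e) else 0)"
proof (cases "h = 1")
  case True
  show ?thesis
  proof (intro coeff_ge_sum)
    fix e
    \<comment> \<open>For h = 1 the comparison is term by term, without neighbours.\<close>
    have "e \<le> A * e" using assms(2) by simp
    then show "eterm k e \<succeq>\<^sub>q (if h dvd e then fps_X ^ (A * (e div h)) * cterm k (2 * e) else 0)"
      using True cterm_antimono[OF assms(3)] by (simp add: eterm_def)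
  qed
next
  case False
  define w :: rat where "w = (if h = 2 then 1 / 2 else 1)"
  have h: "h \<ge> 2" using False assms(1) by simp
  \<comment> \<open>The terms at e = 0 agree on both sides and are set aside, as 0 has no
    predecessor.\<close>
  have set: "{..k} = insert 0 {1..k}" by auto
  show ?thesis
    unfolding coeff_ge_iff
  proof
    fix n
    let ?t = "\<lambda>e. fps_nth (eterm k e) n"
    let ?s = "\<lambda>e. fps_nth (fps_X ^ (A * (e div h)) * cterm k (2 * e)) n"
    have t: "?t e \<ge> 0" for e
    proof -
      have "eterm k e \<succeq>\<^sub>q 0" by (simp add: eterm_def)
      then show ?thesis by (simp add: coeff_ge_iff)
    qed
    \<comment> \<open>The successor of k adds nothing, so the upper end of the sum can return to
      k.\<close>
    have last: "eterm k (k + 1) = 0" by (simp add: eterm_def cterm_def)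
    have "(\<Sum>e\<in>{1..k}. if h dvd e then ?s e else 0) = (\<Sum>e | e \<in> {1..k} \<and> h dvd e. ?s e)"
      by (simp add: sum.inter_filter[symmetric])
    also have "\<dots> \<le> (\<Sum>e | e \<in> {1..k} \<and> h dvd e. ?t e + w * (?t (e - 1) + ?t (e + 1)))"
      using h assms(2) by (intro sum_mono eterm_bound) (auto simp: w_def)
    also have "\<dots> \<le> (\<Sum>e\<in>{1..k+1}. ?t e)"
      by (rule sum_neighbours_le[OF h t w_def])
    also have "\<dots> = (\<Sum>e\<in>{1..k}. ?t e)"
      using last by simp
    finally have "(\<Sum>e\<in>{1..k}. if h dvd e then ?s e else 0) \<le> (\<Sum>e\<in>{1..k}. ?t e)" .
    then show "fps_nth (\<Sum>e\<le>k. if h dvd e then fps_X ^ (A * (e div h)) * cterm k (2 * e) else 0) n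
        \<le> fps_nth (\<Sum>e\<le>k. eterm k e) n"
      unfolding set fps_sum_nth by (simp add: eterm_def if_distrib[of "\<lambda>F. fps_nth F n"] cong: if_cong)
  qed
qed

section \<open>The q-binomial theorem for fractional power series\<close>

lemma cterm_Suc_0: "cterm (Suc k) 0 = geo (Suc k) * cterm k 0"
  by (simp add: cterm_def pinv_Suc)

text \<open>The q-Pascal rule in this normalisation. With u = q^(i+1) and v = q^(k-i) it comes down
  to (1 - v) + v (1 - u) = 1 - u v.\<close>

lemma cterm_Suc_Suc:
  "cterm (Suc k) (Suc i) = geo (Suc k) * (cterm k (Suc i) + fps_X ^ Suc k * cterm k i)"
proof -
  have tri: "Suc i * (Suc i + 1) div 2 = i * (i + 1) div 2 + Suc i" by (simp add: algebra_simps)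
  consider "i < k" | "i = k" | "i > k" by linarith
  then show ?thesis
  proof cases
    case 1
    then obtain K where k: "k = i + Suc K" using less_imp_Suc_add by auto
    define u v where "u = (fps_X ^ Suc i :: rat fps)" and "v = (fps_X ^ Suc K :: rat fps)"
    define T :: "rat fps" where "T = fps_X ^ (i * (i + 1) div 2)"
    have uv: "fps_X ^ Suc k = u * v" unfolding u_def v_def k by (simp flip: power_add)
    have inv: "(1 - u) * geo (Suc i) = 1" "(1 - v) * geo (Suc K) = 1" "(1 - u * v) * geo (Suc k) = 1"
      unfolding uv[symmetric] unfolding u_def v_def by (rule geo_inverse; simp)+
    have c: "cterm (Suc k) (Suc i) = T * u * (pinv i * geo (Suc i)) * (pinv K * geo (Suc K))"
      "cterm k (Suc i) = T * u * (pinv i * geo (Suc i)) * pinv K"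
      "cterm k i = T * pinv i * (pinv K * geo (Suc K))"
      unfolding cterm_def tri T_def u_def pinv_Suc[symmetric] by (simp_all add: k power_add)
    have "T * u * (p * a) * (q * b) = c * (T * u * (p * a) * q + u * v * (T * p * (q * b)))"
      if "(1 - u) * a = 1" "(1 - v) * b = 1" "(1 - u * v) * c = 1" for T u v p q a b c :: "rat fps"
    proof -
      have "u * a * b = c * (u * a * ((1 - v) * b) + u * v * ((1 - u) * a) * b)"
      proof -
        have "c * (u * a * ((1 - v) * b) + u * v * ((1 - u) * a) * b) = ((1 - u * v) * c) * (u * a * b)"
          by (simp add: algebra_simps)
        then show ?thesis unfolding that(3) by simp
      qed
      then have "u * a * b = c * (u * a + u * v * b)" unfolding that by simp
      from arg_cong[OF this, of "\<lambda>t. T * p * q * t"] show ?thesis by (simp add: algebra_simps)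
    qed
    from this[OF inv] show ?thesis unfolding c uv .
  next
    case 2
    then show ?thesis unfolding cterm_def tri by (simp add: pinv_Suc power_add)
  next
    case 3
    then show ?thesis by (simp add: cterm_def)
  qed
qed

lemma fcoeff_qpow_mult:
  assumes "s \<ge> 0"
  shows "fcoeff (qpow s * F) c = fcoeff F (c - s)"
proof -
  \<comment> \<open>The convolution runs over pairs with nonzero coefficients, so at most (s, c - s)
    is present.\<close>
  have "fcoeff (qpow s * F) c = (\<Sum>(a, b) \<in> (if fcoeff F (c - s) = 0 then {} else {(s, c - s)}).
      fcoeff (qpow s) a * fcoeff F b)"
    unfolding times_fracps.rep_eq
    by (rule sum.cong) (use assms in \<open>auto simp: qpow.rep_eq split: if_splits\<close>)
  then show ?thesis using assms by (auto simp: qpow.rep_eq)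
qed

lemma qpow_add: "a \<ge> 0 \<Longrightarrow> b \<ge> 0 \<Longrightarrow> qpow a * qpow b = qpow (a + b)"
  by (rule fracps_eqI) (auto simp: fcoeff_qpow_mult qpow.rep_eq)

lemma qpow_0: "qpow 0 = 1"
  by (rule fracps_eqI) (simp add: qpow.rep_eq one_fracps.rep_eq)

lemma qpow_power: "a \<ge> 0 \<Longrightarrow> qpow a ^ n = qpow (of_nat n * a)"
  by (induction n) (simp_all add: qpow_0 qpow_add distrib_right)

abbreviation embed :: "rat fps \<Rightarrow> fracps" where
  "embed \<equiv> fps_root 1"

lemma embed_hom:
  "embed 0 = 0" "embed 1 = 1" "embed (F + G) = embed F + embed G"
  "embed (F - G) = embed F - embed G" "embed (F * G) = embed F * embed G"
  by (simp_all add: fps_root_0 fps_root_1 fps_root_add fps_root_diff fps_root_mult)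

lemma embed_X_power: "embed (fps_X ^ n) = qpow 1 ^ n"
  by (simp add: fps_root_X_power qpow_power)

lemma geo_embed: "a > 0 \<Longrightarrow> (1 - qpow 1 ^ a) * embed (geo a) = 1"
  using geo_inverse[of a] unfolding embed_X_power[symmetric] embed_hom(2,4,5)[symmetric]
  by (metis embed_hom(2,4,5))

lemma qpoch_Suc: "qpoch z q (Suc n) = qpoch z q n * (1 - z * q ^ n)"
  by (simp add: qpoch_def)

lemma qpoch_pinv: "qpoch (qpow 1) (qpow 1) k * embed (pinv k) = 1"
proof (induction k)
  case 0
  then show ?case by (simp add: qpoch_def embed_hom[simplified])
next
  case (Suc k)
  have "qpoch (qpow 1) (qpow 1) (Suc k) * embed (pinv (Suc k)) =
      (qpoch (qpow 1) (qpow 1) k * embed (pinv k)) * ((1 - qpow 1 ^ Suc k) * embed (geo (Suc k)))"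
    unfolding qpoch_Suc pinv_Suc embed_hom by (simp add: ac_simps)
  then show ?case using Suc geo_embed[of "Suc k"] by simp
qed

text \<open>The step to k + 1 multiplies by (1 - z q^(k+1))/(1 - q^(k+1)); collecting powers of z is
  then the recurrence for \<open>cterm\<close>.\<close>

lemma q_binomial:
  "qpoch (z * qpow 1) (qpow 1) k * embed (pinv k) = (\<Sum>i\<le>k. (- z) ^ i * embed (cterm k i))"
proof (induction k)
  case 0
  then show ?case by (simp add: qpoch_def cterm_def)
next
  case (Suc k)
  let ?c = "\<lambda>i. embed (cterm k i)" and ?Q = "qpow 1 ^ Suc k" and ?g = "embed (geo (Suc k))"
  have "qpoch (z * qpow 1) (qpow 1) (Suc k) * embed (pinv (Suc k)) =
      (qpoch (z * qpow 1) (qpow 1) k * embed (pinv k)) * (1 - z * ?Q) * ?g"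
    unfolding qpoch_Suc pinv_Suc embed_hom by (simp add: ac_simps)
  also have "\<dots> = ?g * (\<Sum>i\<le>k. (- z) ^ i * ?c i) + ?g * ?Q * (\<Sum>i\<le>k. (- z) ^ Suc i * ?c i)"
  proof -
    have "(\<Sum>i\<le>k. (- z) ^ Suc i * ?c i) = - z * (\<Sum>i\<le>k. (- z) ^ i * ?c i)"
      by (simp only: sum_distrib_left power_Suc mult.assoc)
    then show ?thesis unfolding Suc.IH by (simp add: algebra_simps)
  qed
  also have "(\<Sum>i\<le>k. (- z) ^ i * ?c i) = ?c 0 + (\<Sum>i\<le>k. (- z) ^ Suc i * ?c (Suc i))"
  proof -
    have "cterm k (Suc k) = 0" by (simp add: cterm_def)
    then have "(\<Sum>i\<le>k. (- z) ^ i * ?c i) = (\<Sum>i\<le>Suc k. (- z) ^ i * ?c i)"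
      by (simp add: embed_hom[simplified])
    also have "\<dots> = (- z) ^ 0 * ?c 0 + (\<Sum>i\<le>k. (- z) ^ Suc i * ?c (Suc i))"
      by (rule sum.atMost_Suc_shift)
    finally show ?thesis by simp
  qed
  also have "?g * (?c 0 + (\<Sum>i\<le>k. (- z) ^ Suc i * ?c (Suc i))) + ?g * ?Q * (\<Sum>i\<le>k. (- z) ^ Suc i * ?c i) =
      (- z) ^ 0 * embed (cterm (Suc k) 0) + (\<Sum>i\<le>k. (- z) ^ Suc i * embed (cterm (Suc k) (Suc i)))"
    unfolding cterm_Suc_0 cterm_Suc_Suc embed_hom embed_X_power
    by (simp add: sum_distrib_left sum.distrib distrib_left ac_simps del: power_Suc)
  also have "\<dots> = (\<Sum>i\<le>Suc k. (- z) ^ i * embed (cterm (Suc k) i))"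
    by (rule sum.atMost_Suc_shift[symmetric])
  finally show ?case .
qed

lemma G_series_expansion:
  assumes "r \<ge> 0"
  shows "G_series r k = (\<Sum>i\<le>k. (- qpow r) ^ i * embed (cterm k i))"
proof -
  have "inverse (qpoch (qpow 1) (qpow 1) k) = embed (pinv k)"
    by (rule fracps_inverse_unique) (rule qpoch_pinv)
  moreover have "qpow (r + 1) = qpow r * qpow 1" using assms by (simp add: qpow_add)
  ultimately show ?thesis by (simp only: G_series_def divide_fracps_def q_binomial)
qed

section \<open>Integer traces of the binomial terms\<close>

lemma int_trace_add: "int_trace (F + G) = int_trace F + int_trace G"
  by (rule fps_ext) (simp add: int_trace_def plus_fracps.rep_eq)

lemma int_trace_sum: "int_trace (\<Sum>i\<in>S. F i) = (\<Sum>i\<in>S. int_trace (F i))"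
proof (induction S rule: infinite_finite_induct)
  case (insert i S)
  then show ?case by (simp add: int_trace_add)
qed (auto simp: int_trace_def zero_fracps.rep_eq fps_eq_iff)

lemma fcoeff_minus_one_power: "fcoeff ((- 1) ^ i * F) c = (- 1) ^ i * fcoeff F c"
proof (cases "even i")
  case False
  then show ?thesis by (simp add: uminus_fracps.rep_eq)
qed simp

text \<open>\<open>embed F\<close> has integer exponents only and q^(ri) shifts them all by ri, so
  the trace keeps the whole term or none of it. As r >= 0, an integer ri is a natural
  number.\<close>

lemma int_trace_term:
  assumes "r \<ge> 0"
  shows "int_trace ((- qpow r) ^ i * embed F) =
    (if r * of_nat i \<in> \<nat> then (- 1) ^ i * (fps_X ^ nat \<lfloor>r * of_nat i\<rfloor> * F) else 0)"
proof (rule fps_ext)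
  fix n
  let ?s = "r * of_nat i :: rat"
  have s: "?s \<ge> 0" using assms by simp
  have "(- qpow r) ^ i * embed F = (- 1) ^ i * (qpow ?s * embed F)"
    using assms power_minus[of "qpow r" i] by (simp add: qpow_power mult.assoc mult.commute[of r])
  then have L: "fps_nth (int_trace ((- qpow r) ^ i * embed F)) n = (- 1) ^ i * fcoeff (embed F) (of_nat n - ?s)"
    using s by (simp add: int_trace_def fcoeff_minus_one_power fcoeff_qpow_mult)
  have sgn: "fps_nth ((- 1) ^ i * H) n = (- 1) ^ i * fps_nth H n" for H :: "rat fps"
    by (cases "even i") simp_all
  show "fps_nth (int_trace ((- qpow r) ^ i * embed F)) n = fps_nth (if ?s \<in> \<nat>
      then (- 1) ^ i * (fps_X ^ nat \<lfloor>?s\<rfloor> * F) else 0) n"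
  proof (cases "?s \<in> \<nat>")
    case True
    then obtain m where m: "?s = of_nat m" by (auto elim: Nats_cases)
    have "fcoeff (embed F) (of_nat n - of_nat m) = (if n < m then 0 else fps_nth F (n - m))"
    proof (cases "n < m")
      case True
      then have "(of_nat n - of_nat m :: rat) < 0" by simp
      then have "(of_nat n - of_nat m :: rat) \<noteq> of_nat j / of_nat 1" for j
        by (metis div_by_1 not_less of_nat_0_le_iff of_nat_1)
      then have "fcoeff (embed F) (of_nat n - of_nat m) = 0" by (rule fcoeff_fps_root_0)
      then show ?thesis using True by simp
    next
      case False
      then show ?thesis using fcoeff_fps_root[of 1 F "n - m"] by (simp add: of_nat_diff)
    qed
    then show ?thesis using True unfolding L m by (simp add: sgn fps_X_power_mult_nth)
  next
    case False
    have "of_nat n - ?s \<noteq> of_nat j / of_nat 1" for j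
    proof
      assume "of_nat n - ?s = of_nat j / of_nat 1"
      then have "?s = of_nat n - of_nat j" by simp
      \<comment> \<open>Nonnegativity of \<open>?s\<close> forces j <= n, so the truncated
        subtraction is exact.\<close>
      then have "?s = of_nat (n - j)" using s by (simp add: of_nat_diff)
      then show False using False by (metis of_nat_in_Nats)
    qed
    then show ?thesis using False unfolding L by (simp add: fcoeff_fps_root_0)
  qed
qed

lemma T_series_expansion:
  "r \<ge> 0 \<Longrightarrow> T_series r k = (\<Sum>i\<le>k. if r * of_nat i \<in> \<nat>
    then (- 1) ^ i * (fps_X ^ nat \<lfloor>r * of_nat i\<rfloor> * cterm k i) else 0)"
  by (simp only: T_series_def G_series_expansion int_trace_sum int_trace_term)

section \<open>Reduction to even indices\<close>

text \<open>Letting e run up to k rather than k/2 avoids a parity split; the extra terms vanish by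
  the second assumption.\<close>

lemma sum_even_index:
  fixes g :: "nat \<Rightarrow> 'a::comm_monoid_add"
  assumes "\<And>i. odd i \<Longrightarrow> g i = 0" "\<And>i. i > k \<Longrightarrow> g i = 0"
  shows "(\<Sum>i\<le>k. g i) = (\<Sum>e\<le>k. g (2 * e))"
proof -
  have "(\<Sum>i\<le>k. g i) = (\<Sum>i\<le>2 * k. g i)"
    by (rule sum.mono_neutral_left) (use assms in auto)
  also have "\<dots> = (\<Sum>i\<in>(*) 2 ` {..k}. g i)"
  proof (rule sum.mono_neutral_right)
    show "\<forall>i\<in>{..2 * k} - (*) 2 ` {..k}. g i = 0"
    proof
      fix i assume i: "i \<in> {..2 * k} - (*) 2 ` {..k}"
      have "odd i"
      proof
        assume "even i"
        then obtain e where "i = 2 * e" by blast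
        then show False using i by auto
      qed
      then show "g i = 0" by (rule assms(1))
    qed
  qed auto
  also have "\<dots> = (\<Sum>e\<le>k. g (2 * e))"
    by (simp add: sum.reindex inj_on_def)
  finally show ?thesis .
qed

text \<open>Only even i make i/2 an integer, so no negative sign survives.\<close>

lemma T_series_half: "T_series (1 / 2) k = (\<Sum>e\<le>k. eterm k e)"
proof -
  have odd: "(1 / 2 :: rat) * of_nat i \<notin> \<nat>" if "odd i" for i
  proof
    assume "(1 / 2 :: rat) * of_nat i \<in> \<nat>"
    then obtain m where "(1 / 2 :: rat) * of_nat i = of_nat m" by (auto elim: Nats_cases)
    then have "(of_nat i :: rat) = of_nat (2 * m)" by simp
    then show False using that by (simp only: of_nat_eq_iff) simp
  qed
  show ?thesis
    unfolding T_series_expansion[of "1 / 2", simplified]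
    by (subst sum_even_index) (use odd in \<open>auto simp: cterm_def eterm_def\<close>)
qed

lemma T_series_le_even:
  assumes "r \<ge> 0"
  shows "(\<Sum>e\<le>k. if 2 * r * of_nat e \<in> \<nat> then fps_X ^ nat \<lfloor>2 * r * of_nat e\<rfloor> * cterm k (2 * e) else 0)
    \<succeq>\<^sub>q T_series r k"
proof -
  let ?g = "\<lambda>i. if even i \<and> r * of_nat i \<in> \<nat> then fps_X ^ nat \<lfloor>r * of_nat i\<rfloor> * cterm k i else 0"
  have "(\<Sum>i\<le>k. ?g i) \<succeq>\<^sub>q T_series r k"
    unfolding T_series_expansion[OF assms]
  proof (rule coeff_ge_sum)
    fix i
    have "0 \<succeq>\<^sub>q - (fps_X ^ n * cterm k i)" for n
      using coeff_nonneg_mult[OF coeff_nonneg_X_power coeff_nonneg_cterm] by (simp add: coeff_ge_iff)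
    then show "?g i \<succeq>\<^sub>q (if r * of_nat i \<in> \<nat>
        then (- 1) ^ i * (fps_X ^ nat \<lfloor>r * of_nat i\<rfloor> * cterm k i) else 0)"
      by (cases "even i") simp_all
  qed
  also have "(\<Sum>i\<le>k. ?g i) = (\<Sum>e\<le>k. ?g (2 * e))"
    by (rule sum_even_index) (simp_all add: cterm_def)
  also have "(\<Sum>e\<le>k. ?g (2 * e)) = (\<Sum>e\<le>k. if 2 * r * of_nat e \<in> \<nat>
      then fps_X ^ nat \<lfloor>2 * r * of_nat e\<rfloor> * cterm k (2 * e) else 0)"
  proof (rule sum.cong)
    fix e
    have eq: "r * of_nat (2 * e) = 2 * r * of_nat e" by simp
    show "?g (2 * e) = (if 2 * r * of_nat e \<in> \<nat>
        then fps_X ^ nat \<lfloor>2 * r * of_nat e\<rfloor> * cterm k (2 * e) else 0)"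
      unfolding eq by simp
  qed simp
  finally show ?thesis .
qed

theorem theorem1p6:
  fixes r :: rat and k :: nat
  assumes "r > 0" and "1 \<le> k" and "k \<le> 200"
  shows "T_series (1 / 2) k \<succeq>\<^sub>q T_series r k"
proof -
  \<comment> \<open>In lowest terms 2r = A/h, so 2re is an integer exactly when h divides e.\<close>
  obtain a' b' where ab': "2 * r = of_int a' / of_int b'" "b' > 0" "coprime a' b'"
    by (metis Rat_cases Fract_of_int_quotient)
  define A h where "A = nat a'" and "h = nat b'"
  have "a' > 0" using ab' assms(1) by (metis mult_pos_pos of_int_0_less_iff zero_less_divide_iff zero_less_numeral less_asym)
  then have "a' = int A" "b' = int h" using ab'(2) by (simp_all add: A_def h_def)
  then have ab: "2 * r = of_nat A / of_nat h" "h \<ge> 1" "A \<ge> 1" "coprime A h"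
    using ab' \<open>a' > 0\<close> by auto
  have Nats_iff: "2 * r * of_nat e \<in> \<nat> \<longleftrightarrow> h dvd e" for e
  proof
    assume "2 * r * of_nat e \<in> \<nat>"
    then obtain m where "2 * r * of_nat e = of_nat m" by (auto elim: Nats_cases)
    moreover have "of_nat (A * e) = of_nat h * (2 * r * of_nat e)" using ab(1,2) by simp
    ultimately have "(of_nat (A * e) :: rat) = of_nat (h * m)" by (simp only: of_nat_mult)
    then have "h dvd A * e" by (simp only: of_nat_eq_iff dvd_triv_left)
    then show "h dvd e" using ab(4) by (simp add: coprime_dvd_mult_right_iff coprime_commute)
  next
    assume "h dvd e"
    then show "2 * r * of_nat e \<in> \<nat>" using ab by (auto elim!: dvdE)
  qed
  have floor: "nat \<lfloor>2 * r * of_nat e\<rfloor> = A * (e div h)" if e: "h dvd e" for e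
  proof -
    obtain m where "e = h * m" using e by blast
    then have "2 * r * of_nat e = of_nat (A * m)" "e div h = m" using ab by auto
    then show ?thesis by (simp only: floor_of_nat nat_int)
  qed
  have "(\<Sum>e\<le>k. if h dvd e then fps_X ^ (A * (e div h)) * cterm k (2 * e) else 0) \<succeq>\<^sub>q T_series r k"
    using T_series_le_even[of r k] assms(1) unfolding Nats_iff by (simp add: floor cong: if_cong)
  then show ?thesis
    using coeff_ge_trans[OF sum_eterm_ge[OF ab(2,3) assms(2)]] unfolding T_series_half by blast
qed

end
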